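(* Let $p$ be a prime and let $\Gamma\subseteq\mathbb{F}_p^*$ be a multiplicative subgroup with $|\Gamma|\ge c\,\frac{(\log\log p)^2}{\sqrt{\log p}}\,p$ for some fixed constant $c>0$. Then $$\mathrm{sf}(\Gamma)\le\Big(\frac13+o(1)\Big)|\Gamma|,$$ where $o(1)\to0$ as $p\to\infty$.
   Context: $\mathrm{sf}(\Gamma)$ is the maximal size of a subset $S\subseteq\Gamma$ with no solution to $x+y=z$, $x,y,z\in S$ (addition in $\mathbb{F}_p$). *)

theory Defs
  imports Complex_Main "HOL-Number_Theory.Residues"
begin

text \<open>
  Solutions with \<open>x = y\<close> count, so a sum-free set contains no \<open>z\<close> of the form \<open>x \<oplus> x\<close> either.
\<close>

definition sum_free :: "('a, 'b) ring_scheme \<Rightarrow> 'a set \<Rightarrow> bool" where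
  "sum_free R S \<longleftrightarrow> (\<forall>x\<in>S. \<forall>y\<in>S. \<forall>z\<in>S. x \<oplus>\<^bsub>R\<^esub> y \<noteq> z)"

text \<open>Only meaningful for finite \<open>\<Gamma>\<close>, because of \<^const>\<open>Max\<close>.\<close>

definition sf :: "('a, 'b) ring_scheme \<Rightarrow> 'a set \<Rightarrow> nat" where
  "sf R \<Gamma> = Max {card S | S. S \<subseteq> \<Gamma> \<and> sum_free R S}"

end

theory Submission
  imports Defs "HOL-Analysis.Convex" "HOL-Real_Asymp.Real_Asymp"
begin

text \<open>
  Let \<open>S \<subseteq> \<Gamma>\<close> be sum-free with \<open>|S| > (1/3 + \<delta>) |\<Gamma>|\<close>, and let \<open>\<tau> = |\<Gamma>| / p\<close>. Since \<open>\<Gamma>\<close> is invariant under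
  multiplication by its elements, its nontrivial Fourier coefficients are at most \<open>sqrt p\<close>; hence a
  large sieve bounds the number of Fourier coefficients of \<open>S\<close> above \<open>const \<tau> |\<Gamma>|\<close> by
  \<open>const / \<tau>\<^sup>2\<close>. By pigeonhole some set \<open>Q\<close> of size at least \<open>p / (const / \<tau>) ^ (const / \<tau>\<^sup>2)\<close>
  is nearly constant in all these frequencies, and this is where the lower bound on \<open>\<tau>\<close> is needed: it
  makes \<open>Q\<close> much larger than \<open>sqrt p / \<tau>\<close>. Averaging the indicator of \<open>S\<close> over \<open>Q - Q\<close> then barely changes
  the number of solutions of \<open>x + y = z\<close>, yet yields a function bounded by \<open>(1 + \<delta>/4) \<tau>\<close>. That
  function is at least \<open>\<delta> \<tau> / 4\<close> on a set of at least \<open>(1 + \<delta>) p / 3\<close> residues, which by Pollard's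
  theorem contains \<open>const p\<^sup>2\<close> solutions, contradicting that \<open>S\<close> has none.
\<close>

subsection \<open>Periodic functions on the integers\<close>

locale zmod =
  fixes p :: nat
  assumes prime_p: "prime p"
begin

abbreviation P :: "int set" where "P \<equiv> {0..<int p}"

lemma p_pos: "0 < p"
  using prime_p by (simp add: prime_gt_0_nat)

text \<open>Functions on Z/pZ are modelled as functions on all integers that depend only on the
  residue, so that arguments such as \<open>x + a\<close> and \<open>z - x\<close> need no
  reduction.\<close>

definition periodic :: "(int \<Rightarrow> 'a) \<Rightarrow> bool" where
  "periodic f \<longleftrightarrow> (\<forall>x. f (x mod int p) = f x)"

lemma periodic_cong:
  assumes "periodic f" "x mod int p = y mod int p"
  shows "f x = f y"
  using assms unfolding periodic_def by metis

lemma periodicI: "(\<And>x y. x mod int p = y mod int p \<Longrightarrow> f x = f y) \<Longrightarrow> periodic f"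
  unfolding periodic_def by (metis mod_mod_trivial)

lemma mod_in_P: "x mod int p \<in> P"
  using p_pos by simp

lemma inj_translate: "inj_on (\<lambda>x. (x + a) mod int p) P"
proof (rule inj_onI)
  fix x y assume xy: "x \<in> P" "y \<in> P" "(x + a) mod int p = (y + a) mod int p"
  then have "(x + a - a) mod int p = (y + a - a) mod int p"
    by (metis mod_diff_left_eq)
  then show "x = y" using xy by simp
qed

lemma sum_translate:
  fixes f :: "int \<Rightarrow> 'a::comm_monoid_add"
  assumes "periodic f"
  shows "(\<Sum>x\<in>P. f (x + a)) = (\<Sum>x\<in>P. f x)"
proof -
  have "(\<lambda>x. (x + a) mod int p) ` P = P"
    by (rule endo_inj_surj) (use inj_translate mod_in_P in auto)
  then have "(\<Sum>x\<in>P. f x) = (\<Sum>x\<in>P. f ((x + a) mod int p))"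
    using sum.reindex[OF inj_translate, of f a] by simp
  then show ?thesis using assms by (simp add: periodic_def)
qed

lemma sum_reflect:
  fixes f :: "int \<Rightarrow> 'a::comm_monoid_add"
  assumes "periodic f"
  shows "(\<Sum>x\<in>P. f (a - x)) = (\<Sum>x\<in>P. f x)"
proof -
  have inj: "inj_on (\<lambda>x. (a - x) mod int p) P"
  proof (rule inj_onI)
    fix x y assume xy: "x \<in> P" "y \<in> P" "(a - x) mod int p = (a - y) mod int p"
    then have "(a - (a - x)) mod int p = (a - (a - y)) mod int p"
      by (metis mod_diff_right_eq)
    then show "x = y" using xy by simp
  qed
  have "(\<lambda>x. (a - x) mod int p) ` P = P"
    by (rule endo_inj_surj) (use inj mod_in_P in auto)
  then have "(\<Sum>x\<in>P. f x) = (\<Sum>x\<in>P. f ((a - x) mod int p))"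
    using sum.reindex[OF inj, of f] by simp
  then show ?thesis using assms by (simp add: periodic_def)
qed

section \<open>Indicator functions of sets of residues\<close>

definition ind :: "int set \<Rightarrow> int \<Rightarrow> 'a::zero_neq_one" where
  "ind A x = of_bool (x mod int p \<in> A)"

lemma periodic_ind: "periodic (ind A)"
  by (auto simp: periodic_def ind_def)

lemma sum_ind_mult:
  fixes f :: "int \<Rightarrow> 'a::semiring_1"
  assumes "A \<subseteq> P"
  shows "(\<Sum>x\<in>P. ind A x * f x) = (\<Sum>x\<in>A. f x)"
proof -
  have "(\<Sum>x\<in>A. f x) = (\<Sum>x\<in>A. ind A x * f x)"
    by (rule sum.cong) (use assms in \<open>auto simp: ind_def\<close>)
  also have "\<dots> = (\<Sum>x\<in>P. ind A x * f x)"
    by (rule sum.mono_neutral_left) (use assms in \<open>auto simp: ind_def\<close>)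
  finally show ?thesis by simp
qed

lemma sum_ind:
  assumes "A \<subseteq> P"
  shows "(\<Sum>x\<in>P. ind A x) = (of_nat (card A) :: 'a::{semiring_1})"
  using sum_ind_mult[OF assms, of "\<lambda>_. 1"] by simp

subsection \<open>Pollard's theorem\<close>

text \<open>The number of ways to write \<open>z\<close> modulo \<open>p\<close> as an element of
  \<open>A\<close> plus an element of \<open>B\<close>, encoded as the convolution of the two
  indicators.\<close>

definition rep :: "int set \<Rightarrow> int set \<Rightarrow> int \<Rightarrow> nat" where
  "rep A B z = (\<Sum>x\<in>P. ind A x * ind B (z - x))"

lemma periodic_rep: "periodic (rep A B)"
proof (rule periodicI)
  fix x y assume "x mod int p = y mod int p"
  then have "ind B (x - u) = (ind B (y - u) :: nat)" for u
    by (intro periodic_cong[OF periodic_ind]) (metis mod_diff_left_eq)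
  then show "rep A B x = rep A B y" unfolding rep_def by simp
qed

lemma periodic_reflect: "periodic f \<Longrightarrow> periodic (\<lambda>x. f (z - x))"
  by (rule periodicI, erule periodic_cong) (metis mod_diff_right_eq)

lemma periodic_mult: "periodic f \<Longrightarrow> periodic g \<Longrightarrow> periodic (\<lambda>x. f x * g x)"
  by (simp add: periodic_def)

lemma rep_commute: "rep A B z = rep B A z"
proof -
  have "rep B A z = (\<Sum>x\<in>P. ind B (z - x) * ind A (z - (z - x)))"
    unfolding rep_def
    by (rule sum_reflect[symmetric])
       (intro periodic_mult periodic_reflect periodic_ind)
  then show ?thesis by (simp add: rep_def mult.commute)
qed

lemma rep_le: "B \<subseteq> P \<Longrightarrow> rep A B z \<le> card B"
proof -
  assume "B \<subseteq> P"
  have "rep A B z \<le> (\<Sum>x\<in>P. ind B (z - x))"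
    unfolding rep_def by (rule sum_mono) (simp add: ind_def)
  also have "\<dots> = (\<Sum>x\<in>P. ind B x)"
    by (rule sum_reflect[OF periodic_ind])
  also have "\<dots> = card B" using sum_ind[OF \<open>B \<subseteq> P\<close>, where 'a=nat] by simp
  finally show ?thesis .
qed

lemma sum_rep:
  assumes "A \<subseteq> P" "B \<subseteq> P"
  shows "(\<Sum>z\<in>P. rep A B z) = card A * card B"
proof -
  have "(\<Sum>z\<in>P. ind B (z - x)) = card B" for x
    using sum_translate[OF periodic_ind[of B, where 'a=nat], of "-x"]
      sum_ind[OF assms(2), where 'a=nat] by simp
  then have "(\<Sum>z\<in>P. rep A B z) = (\<Sum>x\<in>P. ind A x * card B)"
    unfolding rep_def by (subst sum.swap) (simp flip: sum_distrib_left)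
  then show ?thesis
    using sum_ind[OF assms(1), where 'a=nat] by (simp flip: sum_distrib_right)
qed

lemma rep_translate:
  "rep ((\<lambda>x. (x + e) mod int p) ` A) B z = rep A B (z - e)" if "A \<subseteq> P"
proof -
  let ?A = "(\<lambda>x. (x + e) mod int p) ` A"
  have A: "ind ?A (x + e) = (ind A x :: nat)" for x
  proof -
    have "(x + e) mod int p \<in> ?A \<longleftrightarrow> x mod int p \<in> A"
    proof
      assume "(x + e) mod int p \<in> ?A"
      then obtain y where y: "y \<in> A" "(x mod int p + e) mod int p = (y + e) mod int p"
        by (auto simp: mod_simps)
      then have "x mod int p = y"
        using inj_onD[OF inj_translate[of e], of "x mod int p" y] mod_in_P that by auto
      then show "x mod int p \<in> A" using y by simp
    next
      assume "x mod int p \<in> A"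
      then have "(x mod int p + e) mod int p \<in> ?A" by blast
      then show "(x + e) mod int p \<in> ?A" by (simp add: mod_simps)
    qed
    then show ?thesis by (simp add: ind_def)
  qed
  have "rep ?A B z = (\<Sum>x\<in>P. ind ?A (x + e) * ind B (z - (x + e)))"
    unfolding rep_def
    by (rule sum_translate[symmetric])
       (intro periodic_mult periodic_reflect periodic_ind)
  also have "\<dots> = rep A B (z - e)" by (simp add: rep_def A algebra_simps)
  finally show ?thesis .
qed

text \<open>As \<open>p\<close> is prime, \<open>d\<close> is invertible modulo \<open>p\<close>, so
  the progression \<open>a, a + d, a + 2 * d, ...\<close> visits every residue.\<close>

lemma translation_invariant_full:
  assumes "A \<subseteq> P" "A \<noteq> {}" "d mod int p \<noteq> 0"
    and inv: "\<And>a. a \<in> A \<Longrightarrow> (a + d) mod int p \<in> A"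
  shows "A = P"
proof -
  obtain a where a: "a \<in> A" using assms by auto
  have k: "(a + int k * d) mod int p \<in> A" for k
  proof (induction k)
    case 0 then show ?case using a assms(1) by auto
  next
    case (Suc k)
    from inv[OF Suc] show ?case by (simp add: mod_simps algebra_simps)
  qed
  have "x \<in> A" if x: "x \<in> P" for x
  proof -
    have "\<not> int p dvd d" using assms(3) by auto
    then have "coprime d (int p)"
      using prime_p by (metis coprime_commute prime_imp_coprime_int prime_nat_int_transfer)
    then obtain b where b: "[d * b = 1] (mod int p)" using cong_solve_coprime_int by blast
    \<comment> \<open>The number of steps of length \<open>d\<close> that lead from \<open>a\<close>
      to \<open>x\<close>; reducing modulo \<open>p\<close> makes it nonnegative, so
      \<open>nat\<close> does not change it.\<close>
    define k where "k = nat ((b * (x - a)) mod int p)"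
    have "int k = (b * (x - a)) mod int p" using p_pos by (simp add: k_def)
    then have "[int k = b * (x - a)] (mod int p)" by (simp add: cong_def)
    then have "[int k * d = b * (x - a) * d] (mod int p)" by (rule cong_scalar_right)
    also have "[b * (x - a) * d = (x - a) * (d * b)] (mod int p)" by (simp add: algebra_simps)
    also have "[(x - a) * (d * b) = (x - a) * 1] (mod int p)"
      by (rule cong_scalar_left[OF b])
    finally have "[a + int k * d = a + (x - a)] (mod int p)"
      by (intro cong_add) auto
    then have "(a + int k * d) mod int p = x mod int p" by (simp add: Cong.cong_def)
    then show ?thesis using k[of k] x by simp
  qed
  then show ?thesis using assms(1) by auto
qed

text \<open>The Dyson transform replaces \<open>(A, B)\<close> by \<open>(A \<union> B, A \<inter> B)\<close>; the pairs it loses are those of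
  \<open>(A - B, B - A)\<close>.\<close>

lemma rep_union_inter:
  "rep A B z = rep (A \<union> B) (A \<inter> B) z + rep (A - B) (B - A) z"
proof -
  let ?I = "A \<inter> B"
  have A: "ind A x = ind (A - B) x + (ind ?I x :: nat)"
   and B: "ind B x = ind (B - A) x + (ind ?I x :: nat)"
   and U: "ind (A \<union> B) x = ind (A - B) x + ind (B - A) x + (ind ?I x :: nat)" for x
    by (auto simp: ind_def)
  have "rep A B z = rep (A - B) (B - A) z + rep (A - B) ?I z + rep ?I (B - A) z + rep ?I ?I z"
    unfolding rep_def by (simp add: A B ring_distribs sum.distrib)
  moreover have "rep (A \<union> B) ?I z = rep (A - B) ?I z + rep (B - A) ?I z + rep ?I ?I z"
    unfolding rep_def by (simp add: U ring_distribs sum.distrib)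
  ultimately show ?thesis using rep_commute[of ?I "B - A" z] by simp
qed

text \<open>Strong induction on \<open>card B\<close>. After a translation of \<open>A\<close>, the
  Dyson transform splits the representations between \<open>(A \<union> B, A \<inter> B)\<close> and
  \<open>(A - B, B - A)\<close>, and both pairs have a smaller second set. The first pair suffices
  if \<open>t\<close> is at most the size \<open>k\<close> of the intersection; otherwise the first
  pair is counted in full and the second with threshold \<open>t - k\<close>.\<close>

theorem pollard:
  assumes "A \<subseteq> P" "B \<subseteq> P" "t \<le> card A" "t \<le> card B"
  shows "t * min p (card A + card B - t) \<le> (\<Sum>z\<in>P. min t (rep A B z))"
  using assms
proof (induction "card B" arbitrary: A B t rule: less_induct)
  case less
  note IH = less.hyps and prems = less.prems
  have fin: "finite A" "finite B" using prems finite_subset by auto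
  consider "t = 0" | "t = card B" | "A = P" | "0 < t" "t < card B" "A \<noteq> P"
    using prems by linarith
  then show ?case
  proof cases
    case 1 then show ?thesis by simp
  next
    case 2
    \<comment> \<open>No residue has more than \<open>card B\<close> representations, so the
      truncation at \<open>t\<close> is void.\<close>
    then have "(\<Sum>z\<in>P. min t (rep A B z)) = card A * t"
      using sum_rep[OF prems(1,2)] rep_le[OF prems(2)] by (simp add: min_absorb2)
    then show ?thesis using 2 by (simp add: mult.commute)
  next
    case 3
    have "rep A B z = card B" for z
    proof -
      have "rep A B z = (\<Sum>x\<in>P. ind B (z - x))"
        unfolding rep_def 3 by (simp add: ind_def mod_in_P[simplified])
      also have "\<dots> = (\<Sum>x\<in>P. ind B x)" by (rule sum_reflect[OF periodic_ind])
      finally show ?thesis using sum_ind[OF prems(2), where 'a=nat] by simp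
    qed
    then show ?thesis using prems by (simp add: min_absorb1)
  next
    case 4
    \<comment> \<open>Here \<open>B\<close> has two elements \<open>b1\<close>, \<open>b2\<close>,
      and \<open>A\<close> is not invariant under the shift \<open>b2 - b1\<close>, so some
      \<open>a\<close> in \<open>A\<close> is shifted out of \<open>A\<close>.\<close>
    have "A \<noteq> {}" using 4 prems by auto
    have "\<exists>b1 b2. b1 \<in> B \<and> b2 \<in> B \<and> b1 \<noteq> b2"
      using 4 by (metis card_le_Suc0_iff_eq fin(2) leD less_Suc_eq_le Suc_leI not_less_eq less_trans_Suc)
    then obtain b1 b2 where b: "b1 \<in> B" "b2 \<in> B" "b1 \<noteq> b2" by blast
    have nd: "(b2 - b1) mod int p \<noteq> 0"
      using b prems(2) by (metis atLeastLessThan_iff mod_pos_pos_trivial right_minus_eq subsetD mod_eq_dvd_iff dvd_imp_mod_0 mod_0_imp_dvd)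
    then obtain a where a: "a \<in> A" "(a + (b2 - b1)) mod int p \<notin> A"
      using translation_invariant_full[OF prems(1) \<open>A \<noteq> {}\<close> nd] 4 by blast
    \<comment> \<open>The translation carries \<open>a\<close> to \<open>b1\<close> and keeps
      \<open>b2\<close> outside the image, so the intersection with \<open>B\<close> is neither
      empty nor all of \<open>B\<close>.\<close>
    define A' where "A' = (\<lambda>x. (x + (b1 - a)) mod int p) ` A"
    have A': "A' \<subseteq> P" using mod_in_P by (auto simp: A'_def)
    have cA': "card A' = card A" unfolding A'_def
      by (rule card_image, rule inj_on_subset[OF inj_translate prems(1)])
    have b1: "b1 \<in> A'" using a(1) b(1) prems(2) by (force simp: A'_def)
    have b2: "b2 \<notin> A'"
    proof
      assume "b2 \<in> A'"
      then obtain x where x: "x \<in> A" "b2 = (x + (b1 - a)) mod int p" by (auto simp: A'_def)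
      have "(a + (b2 - b1)) mod int p = ((x + (b1 - a)) mod int p + (a - b1)) mod int p"
        using x(2) by (simp add: algebra_simps)
      also have "\<dots> = x mod int p" by (simp add: mod_simps)
      finally have "(a + (b2 - b1)) mod int p = x mod int p" .
      then show False using x a prems(1) by auto
    qed
    define U I where "U = A' \<union> B" and "I = A' \<inter> B"
    define k where "k = card I"
    have finA': "finite A'" using fin by (simp add: A'_def)
    have IB: "k < card B" unfolding k_def I_def
      by (rule psubset_card_mono) (use fin b b2 in auto)
    have k0: "0 < k" using b b1 fin by (auto simp: k_def I_def card_gt_0_iff)
    have UI: "card U + k = card A + card B"
      unfolding U_def I_def k_def using card_Un_Int[of A' B] fin finA' cA' by simp
    have Up: "card U \<le> p" using card_mono[of P U] A' prems(2) by (auto simp: U_def)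
    have sub: "U \<subseteq> P" "I \<subseteq> P" "A' - B \<subseteq> P" "B - A' \<subseteq> P"
      using A' prems(2) by (auto simp: U_def I_def)
    have cd: "card (A' - B) + k = card A" "card (B - A') + k = card B"
      using card_Int_Diff[of A' B] card_Int_Diff[of B A'] fin finA' cA'
      by (simp_all add: k_def I_def Int_commute)
    have rep: "rep A' B z = rep U I z + rep (A' - B) (B - A') z" for z
      using rep_union_inter[of A' B z] by (simp add: U_def I_def)
    have "t * min p (card A + card B - t) \<le> (\<Sum>z\<in>P. min t (rep A' B z))"
    proof (cases "t \<le> k")
      case True
      have "k \<le> card U" using card_mono[of U I] fin finA' by (auto simp: U_def I_def k_def)
      then have "t * min p (card U + card I - t) \<le> (\<Sum>z\<in>P. min t (rep U I z))"
        using IH[of I U t] sub True IB by (simp add: k_def)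
      also have "\<dots> \<le> (\<Sum>z\<in>P. min t (rep A' B z))"
        by (rule sum_mono) (simp add: rep)
      finally show ?thesis using UI by (simp add: k_def)
    next
      case False
      \<comment> \<open>\<open>rep U I\<close> never exceeds \<open>k\<close>, so the threshold
        \<open>t\<close> can be shared out as \<open>k\<close> for the pair \<open>(U, I)\<close>
        and \<open>s\<close> for the pair of differences.\<close>
      define s where "s = t - k"
      have t: "t = s + k" using False by (simp add: s_def)
      have "s * min p (card (A' - B) + card (B - A') - s)
          \<le> (\<Sum>z\<in>P. min s (rep (A' - B) (B - A') z))"
        by (rule IH) (use sub cd prems t k0 in auto)
      moreover have "min p (card (A' - B) + card (B - A') - s) = card U - t"
        using cd UI t Up by simp
      moreover have "(\<Sum>z\<in>P. rep U I z) + (\<Sum>z\<in>P. min s (rep (A' - B) (B - A') z))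
          \<le> (\<Sum>z\<in>P. min t (rep A' B z))"
        unfolding sum.distrib[symmetric]
      proof (rule sum_mono)
        fix z
        have "rep U I z \<le> k" using rep_le[OF sub(2), of U z] by (simp add: k_def)
        then show "rep U I z + min s (rep (A' - B) (B - A') z) \<le> min t (rep A' B z)"
          using t by (simp add: rep)
      qed
      moreover have "(\<Sum>z\<in>P. rep U I z) = card U * k" using sum_rep[OF sub(1,2)] by (simp add: k_def)
      ultimately have "card U * k + s * (card U - t) \<le> (\<Sum>z\<in>P. min t (rep A' B z))" by simp
      \<comment> \<open>With \<open>t = s + k\<close> the remaining terms \<open>s * k\<close> and
        \<open>k * (k - t)\<close> cancel.\<close>
      moreover have "t * (card U + k - t) = card U * k + s * (card U - t)"
      proof -
        have "t \<le> card U" using prems(3) cA' card_mono[of U A'] fin finA' by (auto simp: U_def)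
        then obtain v where "card U = t + v" by (metis le_add_diff_inverse)
        then show ?thesis using t by (simp add: algebra_simps)
      qed
      ultimately show ?thesis using UI by (metis le_trans mult_le_mono2 min.cobounded2)
    qed
    also have "\<dots> = (\<Sum>z\<in>P. min t (rep A B (z + (a - b1))))"
      unfolding A'_def rep_translate[OF prems(1)] by (simp add: algebra_simps)
    also have "\<dots> = (\<Sum>z\<in>P. min t (rep A B z))"
      by (rule sum_translate[of "\<lambda>z. min t (rep A B z)"]) (use periodic_rep in \<open>simp add: periodic_def\<close>)
    finally show ?thesis .
  qed
qed

subsection \<open>Fourier analysis\<close>

text \<open>The standard additive character of Z/pZ.\<close>

definition e :: "int \<Rightarrow> complex" where
  "e x = cis (2 * pi * (real_of_int x / real p))"

lemma e_0 [simp]: "e 0 = 1"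
  by (simp add: e_def)

lemma e_add: "e (x + y) = e x * e y"
  by (simp add: e_def cis_mult add_divide_distrib ring_distribs)

lemma cnj_e: "cnj (e x) = e (- x)"
  by (simp add: e_def cis_cnj)

lemma norm_e [simp]: "cmod (e x) = 1"
  by (simp add: e_def)

lemma periodic_e: "periodic (\<lambda>x. e (r * x))"
proof (rule periodicI)
  fix x y assume "x mod int p = y mod int p"
  then obtain k where "x = y + int p * k"
    by (metis mod_eqE)
  then have "r * x = r * y + int p * (r * k)" by (simp add: algebra_simps)
  moreover have "e (int p * (r * k)) = 1"
    using p_pos cis_multiple_2pi[of "of_int (r * k)"] by (simp add: e_def)
  ultimately show "e (r * x) = e (r * y)" by (simp add: e_add)
qed

lemma e_eq_1_imp_dvd:
  assumes "e x = 1" shows "int p dvd x"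
proof -
  have "cos (2 * pi * (real_of_int x / real p)) = 1"
    using arg_cong[OF assms, of Re] by (simp add: e_def)
  then obtain n :: int where "2 * pi * (real_of_int x / real p) = of_int n * 2 * pi"
    by (auto simp: cos_one_2pi_int)
  then have "real_of_int x = of_int n * real p" using p_pos by (simp add: field_simps)
  then have "x = n * int p" by (metis of_int_eq_iff of_int_mult of_int_of_nat_eq)
  then show ?thesis by simp
qed

text \<open>Shifting \<open>x\<close> by one multiplies the sum by \<open>e r\<close>, which differs
  from 1 unless \<open>p\<close> divides \<open>r\<close>.\<close>

lemma sum_e:
  "(\<Sum>x\<in>P. e (r * x)) = (if int p dvd r then of_nat p else 0)"
proof (cases "int p dvd r")
  case True
  have "e (r * x) = 1" for x
    using periodic_cong[OF periodic_e[of 1], of "r * x" 0] True by simp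
  then show ?thesis using True by simp
next
  case False
  have "(\<Sum>x\<in>P. e (r * x)) = (\<Sum>x\<in>P. e (r * (x + 1)))"
    by (rule sum_translate[OF periodic_e, symmetric])
  also have "\<dots> = e r * (\<Sum>x\<in>P. e (r * x))"
    by (simp add: e_add ring_distribs sum_distrib_left mult.commute)
  finally have "(1 - e r) * (\<Sum>x\<in>P. e (r * x)) = 0" by (simp add: algebra_simps)
  moreover have "e r \<noteq> 1" using False e_eq_1_imp_dvd by blast
  ultimately show ?thesis using False by simp
qed

text \<open>Unnormalised, so inversion and Parseval carry a factor \<open>p\<close>.\<close>

definition fourier :: "(int \<Rightarrow> real) \<Rightarrow> int \<Rightarrow> complex" where
  "fourier f r = (\<Sum>x\<in>P. of_real (f x) * e (r * x))"

lemma fourier_ind: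
  assumes "A \<subseteq> P"
  shows "fourier (ind A) r = (\<Sum>x\<in>A. e (r * x))"
proof -
  have "of_real (ind A x) = (ind A x :: complex)" for x by (simp add: ind_def)
  then show ?thesis unfolding fourier_def using sum_ind_mult[OF assms] by simp
qed

lemma fourier_ind_zero: "A \<subseteq> P \<Longrightarrow> fourier (ind A) 0 = of_nat (card A)"
  by (simp add: fourier_ind)

lemma norm_fourier_ind_le: "A \<subseteq> P \<Longrightarrow> cmod (fourier (ind A) r) \<le> card A"
  using norm_sum[of "\<lambda>x. e (r * x)" A] by (simp add: fourier_ind)

lemma periodic_fourier: "periodic (fourier f)"
proof (rule periodicI)
  fix r s assume "r mod int p = s mod int p"
  then have "e (r * x) = e (s * x)" for x
    using periodic_cong[OF periodic_e, of r s x] by (simp add: mult.commute)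
  then show "fourier f r = fourier f s" unfolding fourier_def by simp
qed

lemma fourier_inversion:
  assumes "periodic f"
  shows "(\<Sum>r\<in>P. fourier f r * e (- (r * y))) = of_nat p * of_real (f y)"
proof -
  have "(\<Sum>r\<in>P. fourier f r * e (- (r * y)))
      = (\<Sum>x\<in>P. of_real (f x) * (\<Sum>r\<in>P. e ((x - y) * r)))"
    unfolding fourier_def
    by (simp add: sum_distrib_right sum_distrib_left, subst sum.swap)
       (simp add: e_add[symmetric] mult.assoc, simp add: algebra_simps)
  also have "\<dots> = (\<Sum>x\<in>P. if x = y mod int p then of_nat p * of_real (f y) else 0)"
  proof (rule sum.cong[OF refl])
    fix x assume x: "x \<in> P"
    have "int p dvd x - y \<longleftrightarrow> x = y mod int p"
      using x by (metis atLeastLessThan_iff mod_eq_dvd_iff mod_pos_pos_trivial)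
    moreover have "f (y mod int p) = f y" using assms by (simp add: periodic_def)
    ultimately show "of_real (f x) * (\<Sum>r\<in>P. e ((x - y) * r))
        = (if x = y mod int p then of_nat p * of_real (f y) else 0)"
      by (auto simp: sum_e)
  qed
  also have "\<dots> = of_nat p * of_real (f y)" using mod_in_P by (subst sum.delta) auto
  finally show ?thesis .
qed

section \<open>Parseval's identity and the count of solutions on the Fourier side\<close>

lemma cnj_fourier: "cnj (fourier f r) = (\<Sum>x\<in>P. of_real (f x) * e (- (r * x)))"
  by (simp add: fourier_def cnj_e)

lemma parseval:
  fixes f :: "int \<Rightarrow> real"
  assumes "periodic f"
  shows "(\<Sum>r\<in>P. (cmod (fourier f r))\<^sup>2) = p * (\<Sum>x\<in>P. (f x)\<^sup>2)"
proof -
  have "complex_of_real (\<Sum>r\<in>P. (cmod (fourier f r))\<^sup>2)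
      = (\<Sum>r\<in>P. fourier f r * cnj (fourier f r))"
    by (simp only: of_real_sum complex_norm_square)
  also have "\<dots> = (\<Sum>x\<in>P. of_real (f x) * (\<Sum>r\<in>P. fourier f r * e (- (r * x))))"
    unfolding cnj_fourier sum_distrib_left by (subst sum.swap) (simp add: algebra_simps)
  also have "\<dots> = complex_of_real (real p * (\<Sum>x\<in>P. (f x)\<^sup>2))"
    unfolding fourier_inversion[OF assms]
    by (simp add: sum_distrib_left power2_eq_square algebra_simps)
  finally show ?thesis by (simp only: of_real_eq_iff)
qed

lemma parseval_ind:
  assumes "A \<subseteq> P"
  shows "(\<Sum>r\<in>P. (cmod (fourier (ind A) r))\<^sup>2) = real p * real (card A)"
proof -
  have "(ind A x)\<^sup>2 = (ind A x :: real)" for x by (simp add: ind_def)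
  then show ?thesis using parseval[OF periodic_ind] sum_ind[OF assms, where 'a=real] by simp
qed

text \<open>The weighted number of solutions of \<open>x + y = z\<close>, with \<open>y\<close>
  eliminated as \<open>z - x\<close>; for \<open>f = ind S\<close> it counts the solutions inside
  \<open>S\<close>.\<close>

definition triples :: "(int \<Rightarrow> real) \<Rightarrow> real" where
  "triples f = (\<Sum>z\<in>P. \<Sum>x\<in>P. f x * f (z - x) * f z)"

text \<open>The self-convolution \<open>g\<close> of \<open>f\<close> has transform
  \<open>(fourier f r)^2\<close>; pairing \<open>g\<close> with \<open>f\<close> and inverting gives
  the third, conjugated factor.\<close>

lemma triples_fourier:
  assumes f: "periodic f"
  shows "of_real (p * triples f) = (\<Sum>r\<in>P. (fourier f r)\<^sup>2 * cnj (fourier f r))"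
proof -
  define g where "g z = (\<Sum>x\<in>P. f x * f (z - x))" for z
  have g: "periodic g"
  proof (rule periodicI)
    fix x y assume "x mod int p = y mod int p"
    then have "f (x - u) = f (y - u)" for u
      by (intro periodic_cong[OF f]) (metis mod_diff_left_eq)
    then show "g x = g y" unfolding g_def by simp
  qed
  have fg: "fourier g r = (fourier f r)\<^sup>2" for r
  proof -
    have per: "periodic (\<lambda>z. of_real (f z) * e (r * z))"
      using f periodic_e[of r] by (simp add: periodic_def)
    have "fourier g r = (\<Sum>x\<in>P. \<Sum>z\<in>P. of_real (f x) * (of_real (f (z - x)) * e (r * z)))"
      unfolding fourier_def g_def
      by (simp add: sum_distrib_right, subst sum.swap) (simp add: mult.assoc)
    also have "\<dots> = (\<Sum>x\<in>P. of_real (f x) * e (r * x) * (\<Sum>z\<in>P. of_real (f (z - x)) * e (r * (z - x))))"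
    proof -
      have "e (r * z) = e (r * x) * e (r * (z - x))" for x z
        by (simp add: e_add[symmetric] ring_distribs)
      then show ?thesis by (simp add: sum_distrib_left mult_ac)
    qed
    also have "\<dots> = (\<Sum>x\<in>P. of_real (f x) * e (r * x) * fourier f r)"
      using sum_translate[OF per, of "- x" for x] by (simp add: fourier_def)
    finally show ?thesis by (simp add: fourier_def power2_eq_square sum_distrib_right)
  qed
  have "(\<Sum>r\<in>P. (fourier f r)\<^sup>2 * cnj (fourier f r))
      = (\<Sum>z\<in>P. of_real (f z) * (\<Sum>r\<in>P. fourier g r * e (- (r * z))))"
    unfolding cnj_fourier sum_distrib_left fg by (subst sum.swap) (simp add: algebra_simps)
  also have "\<dots> = of_real (p * triples f)"
    unfolding fourier_inversion[OF g]
    by (simp add: triples_def g_def sum_distrib_left sum_distrib_right algebra_simps)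
  finally show ?thesis by simp
qed

subsection \<open>Smoothing\<close>

text \<open>Convolution with the uniform measures on \<open>Q\<close> and on \<open>-Q\<close>.
  Using differences makes the Fourier multiplier real and nonnegative.\<close>

definition smooth :: "int set \<Rightarrow> (int \<Rightarrow> real) \<Rightarrow> int \<Rightarrow> real" where
  "smooth Q f x = (\<Sum>a\<in>Q. \<Sum>b\<in>Q. f (x + (a - b))) / (real (card Q))\<^sup>2"

text \<open>The Fourier multiplier of \<open>smooth Q\<close>.\<close>

definition kernel :: "int set \<Rightarrow> int \<Rightarrow> real" where
  "kernel Q r = (cmod (fourier (ind Q) r))\<^sup>2 / (real (card Q))\<^sup>2"

lemma kernel_nonneg: "0 \<le> kernel Q r"
  by (simp add: kernel_def)

lemma kernel_le_1:
  assumes "Q \<subseteq> P" shows "kernel Q r \<le> 1"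
  unfolding kernel_def
  by (metis norm_fourier_ind_le[OF assms] divide_le_eq_1 norm_ge_zero not_le power_mono zero_le_power2 antisym)

lemma kernel_zero:
  assumes "Q \<subseteq> P" "Q \<noteq> {}" shows "kernel Q 0 = 1"
proof -
  have "finite Q" using assms finite_subset by blast
  then show ?thesis using assms by (simp add: kernel_def fourier_ind_zero)
qed

lemma sum_kernel:
  assumes "Q \<subseteq> P" "Q \<noteq> {}"
  shows "(\<Sum>r\<in>P. kernel Q r) = real p / real (card Q)"
  using parseval_ind[OF assms(1)]
  by (simp add: kernel_def power2_eq_square flip: sum_divide_distrib)

lemma periodic_smooth: "periodic f \<Longrightarrow> periodic (smooth Q f)"
proof (rule periodicI)
  fix x y assume f: "periodic f" and "x mod int p = y mod int p"
  then have "f (x + u) = f (y + u)" for u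
    by (intro periodic_cong[OF f]) (metis mod_add_left_eq)
  then show "smooth Q f x = smooth Q f y" unfolding smooth_def by simp
qed

lemma fourier_smooth:
  assumes f: "periodic f" and Q: "Q \<subseteq> P"
  shows "fourier (smooth Q f) r = fourier f r * of_real (kernel Q r)"
proof -
  \<comment> \<open>Translating by \<open>u\<close> only multiplies the transform by a
    phase.\<close>
  have sh: "(\<Sum>x\<in>P. of_real (f (x + u)) * e (r * x)) = e (- (r * u)) * fourier f r" for u
  proof -
    have per: "periodic (\<lambda>z. of_real (f z) * e (r * z))"
      using f periodic_e[of r] by (simp add: periodic_def)
    have "e (r * x) = e (- (r * u)) * e (r * (x + u))" for x
      by (simp add: e_add[symmetric] ring_distribs)
    then have "(\<Sum>x\<in>P. of_real (f (x + u)) * e (r * x))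
        = e (- (r * u)) * (\<Sum>x\<in>P. of_real (f (x + u)) * e (r * (x + u)))"
      by (simp add: sum_distrib_left mult_ac)
    then show ?thesis using sum_translate[OF per, of u] by (simp add: fourier_def)
  qed
  have "fourier (smooth Q f) r * of_real ((real (card Q))\<^sup>2)
      = (\<Sum>x\<in>P. \<Sum>a\<in>Q. \<Sum>b\<in>Q. of_real (f (x + (a - b))) * e (r * x))"
  proof -
    have eq: "smooth Q f x * (real (card Q))\<^sup>2 = (\<Sum>a\<in>Q. \<Sum>b\<in>Q. f (x + (a - b)))" for x
      using finite_subset[OF Q] by (cases "card Q = 0") (auto simp: smooth_def)
    then have "of_real (smooth Q f x) * e (r * x) * of_real ((real (card Q))\<^sup>2)
        = of_real (\<Sum>a\<in>Q. \<Sum>b\<in>Q. f (x + (a - b))) * e (r * x)" for x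
      by (simp only: eq[symmetric] of_real_mult mult_ac)
    then show ?thesis by (simp add: fourier_def sum_distrib_right)
  qed
  also have "\<dots> = (\<Sum>a\<in>Q. \<Sum>b\<in>Q. \<Sum>x\<in>P. of_real (f (x + (a - b))) * e (r * x))"
    by (subst sum.swap, rule sum.cong[OF refl], rule sum.swap)
  also have "\<dots> = (\<Sum>a\<in>Q. \<Sum>b\<in>Q. e (r * b) * e (- (r * a))) * fourier f r"
    unfolding sh sum_distrib_right
    by (intro sum.cong refl) (simp add: e_add[symmetric] algebra_simps)
  also have "(\<Sum>a\<in>Q. \<Sum>b\<in>Q. e (r * b) * e (- (r * a))) = fourier (ind Q) r * cnj (fourier (ind Q) r)"
    unfolding fourier_ind[OF Q] cnj_sum cnj_e sum_product by (rule sum.swap)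
  also have "\<dots> = of_real ((cmod (fourier (ind Q) r))\<^sup>2)" by (simp only: complex_norm_square)
  finally have eq: "fourier (smooth Q f) r * of_real ((real (card Q))\<^sup>2)
      = of_real ((cmod (fourier (ind Q) r))\<^sup>2) * fourier f r" .
  show ?thesis
  proof (cases "card Q = 0")
    \<comment> \<open>Division by zero yields 0, so both sides vanish.\<close>
    case True
    then show ?thesis by (simp add: kernel_def fourier_def smooth_def)
  next
    case False
    then show ?thesis using eq by (simp add: kernel_def field_simps)
  qed
qed

lemma fourier_zero: "fourier f 0 = of_real (\<Sum>x\<in>P. f x)"
  by (simp add: fourier_def)

lemma sum_smooth:
  assumes "periodic f" "Q \<subseteq> P" "Q \<noteq> {}"
  shows "(\<Sum>x\<in>P. smooth Q f x) = (\<Sum>x\<in>P. f x)"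
  using fourier_smooth[OF assms(1,2), of 0] kernel_zero[OF assms(2,3)]
  unfolding fourier_zero by (simp only: of_real_eq_iff mult_1_right of_real_1)

text \<open>In the inversion formula the zero frequency contributes the mean of \<open>f\<close>.
  Every other one is at most \<open>E\<close> times the kernel, whose total mass is
  \<open>p / card Q\<close> by Parseval, so a large \<open>Q\<close> flattens
  \<open>f\<close>.\<close>

lemma smooth_le:
  assumes f: "periodic f" and Q: "Q \<subseteq> P" "Q \<noteq> {}"
    and bd: "\<And>r. r \<in> P \<Longrightarrow> r \<noteq> 0 \<Longrightarrow> cmod (fourier f r) \<le> E"
    and nonneg: "\<And>x. 0 \<le> f x"
  shows "smooth Q f y \<le> (\<Sum>x\<in>P. f x) / p + E / card Q"
proof -
  let ?F = "\<Sum>x\<in>P. f x"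
  have F: "0 \<le> ?F" by (simp add: nonneg sum_nonneg)
  have E: "0 \<le> E"
    using order_trans[OF norm_ge_zero bd[of 1]] prime_gt_1_nat[OF prime_p] by simp
  have s0: "0 \<le> smooth Q f y" by (simp add: smooth_def nonneg sum_nonneg)
  have "p * smooth Q f y = cmod (\<Sum>r\<in>P. fourier (smooth Q f) r * e (- (r * y)))"
    using fourier_inversion[OF periodic_smooth[OF f], of Q y] s0
    by (simp add: norm_mult)
  also have "\<dots> \<le> (\<Sum>r\<in>P. cmod (fourier (smooth Q f) r * e (- (r * y))))" by (rule norm_sum)
  also have "\<dots> = (\<Sum>r\<in>P. cmod (fourier f r) * kernel Q r)"
    by (simp add: fourier_smooth[OF f Q(1)] norm_mult kernel_nonneg)
  also have "\<dots> \<le> (\<Sum>r\<in>P. (if r = 0 then ?F else 0) + E * kernel Q r)"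
  proof (rule sum_mono)
    fix r assume r: "r \<in> P"
    have "cmod (fourier f 0) = ?F" using F by (simp only: fourier_zero norm_of_real abs_of_nonneg)
    then show "cmod (fourier f r) * kernel Q r \<le> (if r = 0 then ?F else 0) + E * kernel Q r"
      using bd[OF r] kernel_nonneg[of Q r] kernel_zero[OF Q] E F
      by (cases "r = 0") (auto intro: mult_right_mono)
  qed
  also have "\<dots> = ?F + E * (real p / real (card Q))"
    using p_pos by (simp add: sum.distrib sum.delta sum_kernel[OF Q] flip: sum_distrib_left)
  finally show ?thesis using p_pos by (simp add: field_simps)
qed

subsection \<open>The large spectrum of a subset of a multiplicative subgroup\<close>

lemma inj_mult:
  assumes "g mod int p \<noteq> 0" shows "inj_on (\<lambda>x. (g * x) mod int p) P"
proof (rule inj_onI)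
  fix x y assume xy: "x \<in> P" "y \<in> P" "(g * x) mod int p = (g * y) mod int p"
  have "int p dvd g * (x - y)" using xy(3) by (simp add: mod_eq_dvd_iff right_diff_distrib)
  moreover have "\<not> int p dvd g" using assms by auto
  ultimately have "int p dvd x - y"
    using prime_p by (simp add: prime_dvd_mult_iff)
  then show "x = y" using xy(1,2) by (simp add: mod_eq_dvd_iff[symmetric])
qed

text \<open>The transform is constant on the orbits \<open>r \<Gamma>\<close>, which have \<open>card \<Gamma>\<close> elements each, so
  Parseval bounds every nontrivial coefficient.\<close>

lemma norm_fourier_mult_closed_le:
  assumes G: "\<Gamma> \<subseteq> P" "\<Gamma> \<noteq> {}" "0 \<notin> \<Gamma>"
    and closed: "\<And>g x. g \<in> \<Gamma> \<Longrightarrow> x \<in> \<Gamma> \<Longrightarrow> (g * x) mod int p \<in> \<Gamma>"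
    and r: "r mod int p \<noteq> 0"
  shows "cmod (fourier (ind \<Gamma>) r) \<le> sqrt p"
proof -
  have fin: "finite \<Gamma>" using G finite_subset by blast
  have inv: "fourier (ind \<Gamma>) ((r * g) mod int p) = fourier (ind \<Gamma>) r" if g: "g \<in> \<Gamma>" for g
  proof -
    have "g mod int p = g" using g G(1) by auto
    then have "g mod int p \<noteq> 0" using g G(3) by auto
    then have inj: "inj_on (\<lambda>x. (g * x) mod int p) \<Gamma>"
      using inj_on_subset[OF inj_mult G(1)] by blast
    have im: "(\<lambda>x. (g * x) mod int p) ` \<Gamma> = \<Gamma>"
      by (rule endo_inj_surj[OF fin _ inj]) (use closed g in auto)
    have "fourier (ind \<Gamma>) ((r * g) mod int p) = fourier (ind \<Gamma>) (r * g)"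
      using periodic_fourier by (simp add: periodic_def)
    also have "\<dots> = (\<Sum>x\<in>\<Gamma>. e (r * ((g * x) mod int p)))"
      unfolding fourier_ind[OF G(1)]
      using periodic_e[of r] by (simp add: periodic_def mult.assoc)
    also have "\<dots> = (\<Sum>x\<in>\<Gamma>. e (r * x))"
      using sum.reindex[OF inj, of "\<lambda>x. e (r * x)"] im by simp
    finally show ?thesis by (simp add: fourier_ind[OF G(1)])
  qed
  have inj: "inj_on (\<lambda>g. (r * g) mod int p) \<Gamma>"
    using inj_on_subset[OF inj_mult[OF r] G(1)] .
  have "card \<Gamma> * (cmod (fourier (ind \<Gamma>) r))\<^sup>2
      = (\<Sum>g\<in>\<Gamma>. (cmod (fourier (ind \<Gamma>) ((r * g) mod int p)))\<^sup>2)"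
    by (simp add: inv)
  also have "\<dots> = (\<Sum>s\<in>(\<lambda>g. (r * g) mod int p) ` \<Gamma>. (cmod (fourier (ind \<Gamma>) s))\<^sup>2)"
    using sum.reindex[OF inj, of "\<lambda>s. (cmod (fourier (ind \<Gamma>) s))\<^sup>2"] by simp
  also have "\<dots> \<le> (\<Sum>s\<in>P. (cmod (fourier (ind \<Gamma>) s))\<^sup>2)"
    by (rule sum_mono2) (use mod_in_P in auto)
  also have "\<dots> = real p * real (card \<Gamma>)" by (rule parseval_ind[OF G(1)])
  finally have "(cmod (fourier (ind \<Gamma>) r))\<^sup>2 \<le> real p"
    using fin G(2) by (simp add: mult.commute card_gt_0_iff)
  then show ?thesis by (simp add: real_le_rsqrt)
qed

text \<open>Duality: the sum of absolute values is the sum over \<open>S\<close> of a trigonometric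
  polynomial \<open>H\<close> with frequencies in \<open>R\<close>. Cauchy-Schwarz and the inclusion
  of \<open>S\<close> in \<open>\<Gamma>\<close> reduce to the mean square of \<open>H\<close> over
  \<open>\<Gamma>\<close>, where distinct frequencies interact only through nontrivial coefficients
  of \<open>\<Gamma>\<close>.\<close>

lemma large_sieve:
  fixes E :: real
  assumes G: "\<Gamma> \<subseteq> P" "S \<subseteq> \<Gamma>" "R \<subseteq> P"
    and E: "0 \<le> E" "\<And>r. r mod int p \<noteq> 0 \<Longrightarrow> cmod (fourier (ind \<Gamma>) r) \<le> E"
  shows "(\<Sum>r\<in>R. cmod (fourier (ind S) r))\<^sup>2
    \<le> card S * (card R * (card \<Gamma> + card R * E))"
proof -
  have SP: "S \<subseteq> P" using G by auto
  have fin: "finite \<Gamma>" "finite R" using G finite_subset[of \<Gamma> P] finite_subset[of R P] by auto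
  have norm_eq: "complex_of_real a = z \<Longrightarrow> 0 \<le> a \<Longrightarrow> a = cmod z" for a z by auto
  \<comment> \<open>Phases that turn each coefficient into its absolute value; \<open>c r\<close> is
    0 where the coefficient vanishes.\<close>
  define c where "c r = cnj (sgn (fourier (ind S) r))" for r
  have c1: "cmod (c r) \<le> 1" for r by (simp add: c_def norm_sgn)
  have cF: "c r * fourier (ind S) r = of_real (cmod (fourier (ind S) r))" for r
    by (cases "fourier (ind S) r = 0")
       (auto simp: c_def sgn_eq complex_norm_square power2_eq_square field_simps
             simp flip: complex_norm_square)
  define H where "H x = (\<Sum>r\<in>R. c r * e (r * x))" for x
  have HB: "(\<Sum>x\<in>\<Gamma>. (cmod (H x))\<^sup>2) \<le> card R * (card \<Gamma> + card R * E)"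
  proof -
    have "complex_of_real (\<Sum>x\<in>\<Gamma>. (cmod (H x))\<^sup>2) = (\<Sum>x\<in>\<Gamma>. H x * cnj (H x))"
      by (simp only: of_real_sum complex_norm_square)
    also have "\<dots> = (\<Sum>x\<in>\<Gamma>. \<Sum>r\<in>R. \<Sum>s\<in>R. c r * cnj (c s) * e ((r - s) * x))"
    proof (rule sum.cong[OF refl])
      fix x
      have *: "(c r * e (r * x)) * (cnj (c s) * e (- (s * x))) = c r * cnj (c s) * e ((r - s) * x)" for r s
      proof -
        have "(r - s) * x = r * x + - (s * x)" by (simp add: algebra_simps)
        then show ?thesis by (simp only: e_add mult_ac)
      qed
      then show "H x * cnj (H x) = (\<Sum>r\<in>R. \<Sum>s\<in>R. c r * cnj (c s) * e ((r - s) * x))"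
        unfolding H_def cnj_sum sum_product complex_cnj_mult cnj_e
        by (simp only: *)
    qed
    also have "\<dots> = (\<Sum>r\<in>R. \<Sum>s\<in>R. \<Sum>x\<in>\<Gamma>. c r * cnj (c s) * e ((r - s) * x))"
      by (subst sum.swap, rule sum.cong[OF refl], rule sum.swap)
    also have "\<dots> = (\<Sum>r\<in>R. \<Sum>s\<in>R. c r * cnj (c s) * fourier (ind \<Gamma>) (r - s))"
      by (simp add: fourier_ind[OF G(1)] sum_distrib_left)
    finally have "(\<Sum>x\<in>\<Gamma>. (cmod (H x))\<^sup>2)
        = cmod (\<Sum>r\<in>R. \<Sum>s\<in>R. c r * cnj (c s) * fourier (ind \<Gamma>) (r - s))"
      by (rule norm_eq) (simp add: sum_nonneg)
    \<comment> \<open>The diagonal gives \<open>card \<Gamma>\<close>; adding \<open>E\<close> there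
      too keeps the total simple.\<close>
    also have "\<dots> \<le> (\<Sum>r\<in>R. \<Sum>s\<in>R. (if s = r then real (card \<Gamma>) else 0) + E)"
    proof (intro order_trans[OF norm_sum] sum_mono)
      fix r s assume rs: "r \<in> R" "s \<in> R"
      have "cmod (c r * cnj (c s) * fourier (ind \<Gamma>) (r - s)) \<le> 1 * cmod (fourier (ind \<Gamma>) (r - s))"
        unfolding norm_mult complex_mod_cnj
        by (intro mult_right_mono mult_le_one c1) auto
      also have "\<dots> \<le> (if s = r then real (card \<Gamma>) else 0) + E"
      proof (cases "s = r")
        case True
        then show ?thesis using E(1) by (simp add: fourier_ind_zero[OF G(1)])
      next
        case False
        then have "(r - s) mod int p \<noteq> 0"
          using rs G(3) by (metis atLeastLessThan_iff dvd_imp_mod_0 mod_0_imp_dvd mod_eq_dvd_iff mod_pos_pos_trivial subsetD)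
        then show ?thesis using E(2) False by simp
      qed
      finally show "cmod (c r * cnj (c s) * fourier (ind \<Gamma>) (r - s))
          \<le> (if s = r then real (card \<Gamma>) else 0) + E" .
    qed
    also have "\<dots> = card R * (card \<Gamma> + card R * E)"
      using fin by (simp add: sum.distrib sum.delta)
    finally show ?thesis .
  qed
  have "complex_of_real (\<Sum>r\<in>R. cmod (fourier (ind S) r)) = (\<Sum>r\<in>R. c r * fourier (ind S) r)"
    by (simp add: cF)
  also have "\<dots> = (\<Sum>x\<in>S. H x)"
    unfolding fourier_ind[OF SP] H_def sum_distrib_left by (rule sum.swap)
  finally have "(\<Sum>r\<in>R. cmod (fourier (ind S) r)) = cmod (\<Sum>x\<in>S. H x)"
    by (rule norm_eq) (simp add: sum_nonneg)
  also have "\<dots> \<le> (\<Sum>x\<in>S. cmod (H x))" by (rule norm_sum)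
  finally have "(\<Sum>r\<in>R. cmod (fourier (ind S) r))\<^sup>2 \<le> (\<Sum>x\<in>S. cmod (H x))\<^sup>2"
    by (intro power_mono) (simp_all add: sum_nonneg)
  also have "\<dots> \<le> (\<Sum>x\<in>S. (cmod (H x))\<^sup>2) * card S"
    by (rule sum_squared_le_sum_of_squares)
  also have "\<dots> \<le> (\<Sum>x\<in>\<Gamma>. (cmod (H x))\<^sup>2) * card S"
    by (intro mult_right_mono sum_mono2) (use G fin in auto)
  also have "\<dots> \<le> card R * (card \<Gamma> + card R * E) * card S"
    by (intro mult_right_mono HB) simp
  finally show ?thesis by (simp add: mult.commute)
qed

text \<open>With \<open>E = sqrt p\<close> and \<open>D\<close> large frequencies, the sieve gives
  \<open>D * \<theta>^2 \<le> n^2 + D * n * q\<close>. The hypothesis \<open>large\<close> says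
  exactly that \<open>n * q \<le> \<theta>^2 / 2\<close>, so the last term is absorbed and
  \<open>D \<le> 2 * n^2 / \<theta>^2\<close> remains.\<close>

lemma card_large_spectrum_le:
  fixes k \<tau> :: real
  assumes G: "\<Gamma> \<subseteq> P" "\<Gamma> \<noteq> {}" "0 \<notin> \<Gamma>"
    and closed: "\<And>g x. g \<in> \<Gamma> \<Longrightarrow> x \<in> \<Gamma> \<Longrightarrow> (g * x) mod int p \<in> \<Gamma>"
    and S: "S \<subseteq> \<Gamma>" and k: "0 < k" and tau: "\<tau> = card \<Gamma> / p"
    and large: "8 \<le> k\<^sup>2 * \<tau> ^ 3 * sqrt p"
  shows "card {r\<in>P. k / 2 * \<tau> * card \<Gamma> \<le> cmod (fourier (ind S) r)} \<le> 8 / (k\<^sup>2 * \<tau>\<^sup>2)"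
proof -
  define n where "n = real (card \<Gamma>)"
  define q where "q = sqrt (real p)"
  define \<theta> where "\<theta> = k / 2 * \<tau> * n"
  define R where "R = {r\<in>P. \<theta> \<le> cmod (fourier (ind S) r)}"
  define D where "D = real (card R)"
  have n: "0 < n" using G finite_subset[of \<Gamma> P] by (auto simp: n_def card_gt_0_iff)
  have q: "0 < q" "q * q = p" using p_pos by (simp_all add: q_def)
  have t: "0 < \<tau>" using n p_pos by (simp add: tau n_def)
  have np: "n = \<tau> * (q * q)" using q p_pos by (simp add: tau n_def)
  have th: "0 < \<theta>" using k t n by (simp add: \<theta>_def)
  have D0: "0 \<le> D" by (simp add: D_def)
  have "D * \<theta> = (\<Sum>r\<in>R. \<theta>)" by (simp add: D_def)
  also have "\<dots> \<le> (\<Sum>r\<in>R. cmod (fourier (ind S) r))" by (rule sum_mono) (simp add: R_def)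
  finally have "(D * \<theta>)\<^sup>2 \<le> (\<Sum>r\<in>R. cmod (fourier (ind S) r))\<^sup>2"
    using D0 th by (intro power_mono) simp_all
  also have "\<dots> \<le> card S * (card R * (card \<Gamma> + card R * q))"
    unfolding q_def
    by (rule large_sieve[OF G(1) S])
       (use norm_fourier_mult_closed_le[OF G closed] in \<open>auto simp: R_def\<close>)
  also have "\<dots> \<le> n * (D * (n + D * q))"
    unfolding n_def[symmetric] D_def[symmetric]
    using S finite_subset[of \<Gamma> P] G n q D0
    by (intro mult_right_mono) (auto simp: n_def card_mono)
  finally have main: "D * (D * \<theta>\<^sup>2) \<le> D * (n\<^sup>2 + D * (n * q))"
    by (simp add: power2_eq_square algebra_simps)
  have "8 * (n * q) \<le> k\<^sup>2 * \<tau> ^ 3 * q * (n * q)"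
    using large n q by (intro mult_right_mono) (auto simp: q_def)
  also have "\<dots> = 4 * \<theta>\<^sup>2"
    by (simp add: \<theta>_def np power2_eq_square power3_eq_cube)
  finally have "D * (n * q) \<le> D * (\<theta>\<^sup>2 / 2)"
    using D0 by (intro mult_left_mono) simp_all
  moreover have "D * \<theta>\<^sup>2 \<le> n\<^sup>2 + D * (n * q)"
  proof (cases "D = 0")
    case False
    then show ?thesis using main D0 by (simp only: mult_le_cancel_left)
  qed simp
  ultimately have "D * \<theta>\<^sup>2 \<le> 2 * n\<^sup>2" by (simp add: algebra_simps)
  then have "D * (k\<^sup>2 * \<tau>\<^sup>2) * n\<^sup>2 \<le> 8 * n\<^sup>2"
    by (simp add: \<theta>_def power_mult_distrib power_divide)
  then have "D * (k\<^sup>2 * \<tau>\<^sup>2) \<le> 8" using n by (simp only: mult_le_cancel_right) auto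
  then have "D \<le> 8 / (k\<^sup>2 * \<tau>\<^sup>2)" using k t by (simp add: pos_le_divide_eq)
  then show ?thesis by (simp add: D_def R_def \<theta>_def n_def)
qed

subsection \<open>Cells of almost constant phase\<close>

text \<open>Pigeonhole: cut the circle into \<open>M\<close> equal arcs and record, for each
  \<open>r\<close> in \<open>R\<close>, which arc contains \<open>r * x\<close>. There are
  \<open>M ^ card R\<close> possible records, and \<open>Q\<close> is a fibre of at least average
  size.\<close>

lemma exists_cell:
  assumes R: "finite R" and M: "0 < M"
  obtains Q where "Q \<subseteq> P" "Q \<noteq> {}" "p \<le> card Q * M ^ card R"
    "\<And>r x y. r \<in> R \<Longrightarrow> x \<in> Q \<Longrightarrow> y \<in> Q
      \<Longrightarrow> int M * \<bar>(r * x) mod int p - (r * y) mod int p\<bar> \<le> int p"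
proof -
  define \<phi> where "\<phi> x = (\<lambda>r\<in>R. (int M * ((r * x) mod int p)) div int p)" for x
  let ?B = "R \<rightarrow>\<^sub>E {0..<int M}"
  have fB: "finite ?B" using R by (intro finite_PiE) auto
  have cB: "card ?B = M ^ card R" using R by (simp add: card_funcsetE)
  have \<phi>: "\<phi> \<in> P \<rightarrow> ?B"
  proof (intro Pi_I PiE_I)
    fix x r assume "r \<in> R"
    have "int M * ((r * x) mod int p) < int M * int p"
      using M p_pos by (intro mult_strict_left_mono) auto
    moreover have "(int M * ((r * x) mod int p)) div int p * int p \<le> int M * ((r * x) mod int p)"
    proof -
      have "a div q * q \<le> a" if "0 < q" for a q :: int
        using pos_mod_sign[OF that, of a] div_mult_mod_eq[of a q] by linarith
      then show ?thesis using p_pos by simp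
    qed
    ultimately have "(int M * ((r * x) mod int p)) div int p * int p < int M * int p"
      by (rule le_less_trans[rotated])
    then have "(int M * ((r * x) mod int p)) div int p < int M"
      by (rule mult_right_less_imp_less) simp
    then show "\<phi> x r \<in> {0..<int M}"
      using p_pos \<open>r \<in> R\<close> by (simp add: \<phi>_def pos_imp_zdiv_nonneg_iff)
  qed (simp add: \<phi>_def)
  have "card ?B > 0" using cB M by simp
  then have "?B \<noteq> {}" by force
  then obtain v where v: "card (\<phi> -` {v} \<inter> P) * card ?B \<ge> card P"
    using pigeonhole_card[OF \<phi> _ fB] by auto
  define Q where "Q = \<phi> -` {v} \<inter> P"
  have big: "p \<le> card Q * M ^ card R" using v cB by (simp add: Q_def)
  show ?thesis
  proof (rule that[OF _ _ big])
    show "Q \<subseteq> P" by (simp add: Q_def)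
    show "Q \<noteq> {}" using big p_pos by auto
    fix r x y assume r: "r \<in> R" and xy: "x \<in> Q" "y \<in> Q"
    have "\<phi> x r = \<phi> y r" using xy by (simp add: Q_def)
    then have eq: "(int M * ((r * x) mod int p)) div int p = (int M * ((r * y) mod int p)) div int p"
      using r by (simp add: \<phi>_def)
    \<comment> \<open>Numbers with equal quotient by \<open>p\<close> differ only in their
      remainders.\<close>
    have "\<bar>u - w\<bar> \<le> int p" if "u div int p = w div int p" for u w
    proof -
      have "u = u div int p * int p + u mod int p" "w = w div int p * int p + w mod int p"
        by simp_all
      moreover have "0 \<le> u mod int p" "u mod int p < int p" "0 \<le> w mod int p" "w mod int p < int p"
        using p_pos by simp_all
      ultimately show ?thesis using that by (simp only:)
    qed
    from this[OF eq] show "int M * \<bar>(r * x) mod int p - (r * y) mod int p\<bar> \<le> int p"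
      by (simp add: abs_mult flip: right_diff_distrib)
  qed
qed

text \<open>A chord is no longer than its arc: its length is twice the sine of half the angle, in
  absolute value.\<close>

lemma norm_cis_diff_le: "cmod (cis a - cis b) \<le> \<bar>a - b\<bar>"
proof -
  have "cis a - cis b = cis b * (cis (a - b) - 1)"
    by (simp add: right_diff_distrib cis_mult)
  then have "(cmod (cis a - cis b))\<^sup>2 = (cmod (cis (a - b) - 1))\<^sup>2"
    by (simp add: norm_mult)
  also have "\<dots> = 2 - 2 * cos (a - b)"
    by (simp add: cmod_power2 power2_diff sin_squared_eq)
  also have "\<dots> = (2 * \<bar>sin ((a - b) / 2)\<bar>)\<^sup>2"
  proof -
    have "2 * ((a - b) / 2) = a - b" by simp
    with cos_double_sin[of "(a - b) / 2"]
    have "cos (a - b) = 1 - 2 * (sin ((a - b) / 2))\<^sup>2" by (simp only:)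
    then show ?thesis by (simp add: power_mult_distrib)
  qed
  also have "\<dots> \<le> \<bar>a - b\<bar>\<^sup>2"
    using abs_sin_x_le_abs_x[of "(a - b) / 2"] by (intro power_mono) auto
  finally show ?thesis by (rule power2_le_imp_le) simp
qed

text \<open>All terms \<open>e (r * x)\<close> with \<open>x\<close> in \<open>Q\<close> lie within
  \<open>h = 2 * pi / M\<close> of one another, so their mean has modulus at least
  \<open>1 - h\<close>. Squaring costs a factor 2 in \<open>h\<close>; for \<open>h > 1\<close> the
  bound is negative.\<close>

lemma kernel_cell_ge:
  assumes Q: "Q \<subseteq> P" "Q \<noteq> {}" and M: "0 < M"
    and close: "\<And>x y. x \<in> Q \<Longrightarrow> y \<in> Q
      \<Longrightarrow> int M * \<bar>(r * x) mod int p - (r * y) mod int p\<bar> \<le> int p"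
  shows "1 - 4 * pi / M \<le> kernel Q r"
proof -
  have fin: "finite Q" using Q finite_subset by auto
  then have m: "0 < card Q" using Q by auto
  obtain y where y: "y \<in> Q" using Q by auto
  let ?h = "2 * pi / real M"
  have d: "cmod (e (r * x) - e (r * y)) \<le> ?h" if x: "x \<in> Q" for x
  proof -
    have red: "e u = e (u mod int p)" for u
      using periodic_e[of 1] by (simp add: periodic_def)
    have "cmod (e (r * x) - e (r * y)) = cmod (e ((r * x) mod int p) - e ((r * y) mod int p))"
      by (simp only: red[symmetric])
    also have "\<dots> \<le> \<bar>2 * pi * (real_of_int ((r * x) mod int p) / real p) - 2 * pi * (real_of_int ((r * y) mod int p) / real p)\<bar>"
      unfolding e_def by (rule norm_cis_diff_le)
    also have "\<dots> = 2 * pi / real p * real_of_int \<bar>(r * x) mod int p - (r * y) mod int p\<bar>"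
    proof -
      have "2 * pi * (a / real p) - 2 * pi * (b / real p) = 2 * pi / real p * (a - b)" for a b
        by (simp add: diff_divide_distrib algebra_simps)
      then show ?thesis by (simp only: abs_mult of_int_diff of_int_abs) simp
    qed
    also have "\<dots> \<le> 2 * pi / real p * (real p / real M)"
    proof (intro mult_left_mono)
      have "real M * real_of_int \<bar>(r * x) mod int p - (r * y) mod int p\<bar> \<le> real p"
        using close[OF x y] by (metis of_int_le_iff of_int_mult of_int_of_nat_eq)
      then show "real_of_int \<bar>(r * x) mod int p - (r * y) mod int p\<bar> \<le> real p / real M"
        using M by (simp add: pos_le_divide_eq mult.commute)
    qed simp
    finally show ?thesis using p_pos by simp
  qed
  have "of_nat (card Q) * e (r * y) = fourier (ind Q) r - (\<Sum>x\<in>Q. e (r * x) - e (r * y))"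
    by (simp add: fourier_ind[OF Q(1)] sum_subtractf)
  then have "real (card Q) \<le> cmod (fourier (ind Q) r) + cmod (\<Sum>x\<in>Q. e (r * x) - e (r * y))"
    by (metis norm_e norm_mult norm_of_nat norm_triangle_ineq4 mult_1_right)
  also have "cmod (\<Sum>x\<in>Q. e (r * x) - e (r * y)) \<le> real (card Q) * ?h"
    by (rule sum_norm_le[THEN order_trans, of _ _ "\<lambda>_. ?h"]) (use d in auto)
  finally have ge: "1 - ?h \<le> cmod (fourier (ind Q) r) / card Q"
    using m by (simp add: field_simps)
  show ?thesis
  proof (cases "?h \<le> 1")
    case True
    have "1 - 2 * ?h \<le> (1 - ?h)\<^sup>2" by (simp add: power2_diff)
    also have "\<dots> \<le> (cmod (fourier (ind Q) r) / card Q)\<^sup>2"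
      using ge True by (intro power_mono) auto
    finally show ?thesis by (simp add: kernel_def power_divide)
  next
    case False
    then have "1 - 2 * ?h \<le> 0" by linarith
    then show ?thesis using kernel_nonneg[of Q r] by simp
  qed
qed

subsection \<open>Counting solutions\<close>

text \<open>Smoothing multiplies each term of \<open>triples_fourier\<close> by the cube of the real
  number \<open>kernel Q r\<close>. In the difference one factor of each term is bounded through
  \<open>\<theta>\<close>, and Parseval sums the remaining squares.\<close>

lemma triples_smooth_diff_le:
  assumes S: "S \<subseteq> P" and Q: "Q \<subseteq> P"
    and bd: "\<And>r. r \<in> P \<Longrightarrow> cmod (fourier (ind S) r) * (1 - kernel Q r ^ 3) \<le> \<theta>"
  shows "\<bar>triples (ind S) - triples (smooth Q (ind S))\<bar> \<le> \<theta> * card S"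
proof -
  let ?F = "fourier (ind S)"
  have "complex_of_real (real p * (triples (ind S) - triples (smooth Q (ind S))))
      = of_real (p * triples (ind S)) - of_real (p * triples (smooth Q (ind S)))"
    by (simp add: right_diff_distrib)
  also have "\<dots> = (\<Sum>r\<in>P. (?F r)\<^sup>2 * cnj (?F r) * of_real (1 - kernel Q r ^ 3))"
    unfolding triples_fourier[OF periodic_ind] triples_fourier[OF periodic_smooth[OF periodic_ind]]
      fourier_smooth[OF periodic_ind Q] sum_subtractf[symmetric]
    by (rule sum.cong) (simp_all add: power2_eq_square power3_eq_cube algebra_simps)
  finally have "real p * \<bar>triples (ind S) - triples (smooth Q (ind S))\<bar>
      = cmod (\<Sum>r\<in>P. (?F r)\<^sup>2 * cnj (?F r) * of_real (1 - kernel Q r ^ 3))"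
    by (metis abs_mult abs_of_nat norm_of_real)
  also have "\<dots> \<le> (\<Sum>r\<in>P. \<theta> * (cmod (?F r))\<^sup>2)"
  proof (intro order_trans[OF norm_sum] sum_mono)
    fix r assume r: "r \<in> P"
    have "kernel Q r ^ 3 \<le> 1" using kernel_nonneg kernel_le_1[OF Q] by (simp add: power_le_one)
    then have "cmod ((?F r)\<^sup>2 * cnj (?F r) * of_real (1 - kernel Q r ^ 3))
        = (cmod (?F r))\<^sup>2 * (cmod (?F r) * (1 - kernel Q r ^ 3))"
      unfolding norm_mult norm_power complex_mod_cnj norm_of_real by simp
    also have "\<dots> \<le> (cmod (?F r))\<^sup>2 * \<theta>" by (intro mult_left_mono bd r) simp
    finally show "cmod ((?F r)\<^sup>2 * cnj (?F r) * of_real (1 - kernel Q r ^ 3)) \<le> \<theta> * (cmod (?F r))\<^sup>2"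
      by (simp add: mult.commute)
  qed
  also have "\<dots> = real p * (\<theta> * card S)"
    using parseval_ind[OF S] by (simp flip: sum_distrib_left)
  finally show ?thesis using p_pos by simp
qed

text \<open>Pollard's theorem for \<open>A + A\<close> with threshold \<open>t\<close> near
  \<open>d * p / 2\<close>. Residues outside \<open>A\<close> account for at most
  \<open>t * (p - card A)\<close> of the truncated count; as \<open>A\<close> exceeds a third of all
  residues, a positive share is left for sums in \<open>A\<close>.\<close>

lemma triples_ind_ge:
  fixes d :: real
  assumes A: "A \<subseteq> P" and d: "0 < d" "d \<le> 1" "4 \<le> d * p"
    and big: "(1 + d) * p \<le> 3 * card A"
  shows "d\<^sup>2 * (real p)\<^sup>2 / 8 \<le> triples (ind A)"
proof -
  have fin: "finite A" using A finite_subset by auto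
  define t where "t = nat \<lfloor>d * p / 2\<rfloor>"
  \<comment> \<open>Rounding down loses less than 1, and \<open>4 \<le> d * p\<close> makes this at
    most \<open>d * p / 4\<close>.\<close>
  have t: "real t \<le> d * p / 2" "d * p / 4 \<le> real t" using d unfolding t_def by linarith+
  have dp: "d * p \<le> p" using d by (simp add: mult_left_le_one_le)
  have aP: "card A \<le> p" using card_mono[of P A] A by simp
  have big': "real p + d * p \<le> 3 * card A" using big by (simp add: algebra_simps)
  have tA: "t \<le> card A" using t big' dp by linarith
  have T: "triples (ind A) = (\<Sum>z\<in>A. real (rep A A z))"
  proof -
    have "triples (ind A) = (\<Sum>z\<in>P. ind A z * real (rep A A z))"
    proof -
      have "real (ind A x) = ind A x" for x by (simp add: ind_def)
      then show ?thesis
        unfolding triples_def rep_def by (simp add: sum_distrib_left mult_ac)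
    qed
    then show ?thesis by (simp add: sum_ind_mult[OF A])
  qed
  have "t * min p (card A + card A - t) \<le> (\<Sum>z\<in>P. min t (rep A A z))"
    by (rule pollard) (use A tA in auto)
  also have "\<dots> = (\<Sum>z\<in>A. min t (rep A A z)) + (\<Sum>z\<in>P - A. min t (rep A A z))"
    using sum.subset_diff[OF A] by (simp add: add.commute)
  also have "\<dots> \<le> (\<Sum>z\<in>A. rep A A z) + (\<Sum>z\<in>P - A. t)"
    by (intro add_mono sum_mono) auto
  also have "(\<Sum>z\<in>P - A. t) = t * (p - card A)"
    using card_Diff_subset[OF fin A] by simp
  finally have "real (t * min p (card A + card A - t)) \<le> real ((\<Sum>z\<in>A. rep A A z) + t * (p - card A))"
    by (rule of_nat_mono)
  then have "real t * real (min p (card A + card A - t))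
      \<le> triples (ind A) + real t * (real p - real (card A))"
    by (simp only: T of_nat_add of_nat_mult of_nat_sum of_nat_diff[OF aP])
  then have "real t * (real (min p (card A + card A - t)) - real p + real (card A)) \<le> triples (ind A)"
    by (simp add: algebra_simps)
  moreover have "d * p / 2 \<le> real (min p (card A + card A - t)) - real p + real (card A)"
  proof -
    have "real (card A + card A - t) = 2 * real (card A) - real t" using tA by simp
    then show ?thesis using t big' dp by (simp add: min_def)
  qed
  moreover have "d * p / 4 * (d * p / 2) \<le> real t * (d * p / 2)"
    using t d by (intro mult_right_mono) auto
  ultimately have "d * p / 4 * (d * p / 2) \<le> triples (ind A)"
    by (meson mult_left_mono of_nat_0_le_iff order_trans)
  then show ?thesis by (simp add: power2_eq_square mult_ac)
qed

section \<open>Sum-free sets and the bound for a single prime\<close>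

lemma triples_sum_free:
  assumes "S \<subseteq> P" and sf: "\<And>x y. x \<in> S \<Longrightarrow> y \<in> S \<Longrightarrow> (x + y) mod int p \<notin> S"
  shows "triples (ind S) = 0"
  unfolding triples_def
proof (intro sum.neutral ballI)
  fix z x assume "z \<in> P" "x \<in> P"
  then have "(x + (z - x) mod int p) mod int p = z" "x mod int p = x" "z mod int p = z"
    by (simp_all add: mod_simps)
  then show "ind S x * ind S (z - x) * ind S z = (0 :: real)"
    using sf[of x "(z - x) mod int p"] by (auto simp: ind_def)
qed

text \<open>The upper bound on \<open>g\<close> prevents its mass from concentrating, so the set
  \<open>A\<close> where \<open>g\<close> is not small has more than a third of the residues. There
  \<open>g\<close> dominates \<open>\<delta> * \<tau> / 4\<close> times an indicator; the constant
  is \<open>(1/4)^3 * (1/8) = 1/512\<close>.\<close>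

lemma triples_ge_of_bounded:
  fixes \<delta> \<tau> :: real
  assumes g: "periodic g" "\<And>x. 0 \<le> g x" "\<And>x. g x \<le> \<tau> * (1 + \<delta> / 4)"
    and \<delta>: "0 < \<delta>" "\<delta> \<le> 1" "4 \<le> \<delta> * p" and t: "0 < \<tau>"
    and dens: "(1/3 + \<delta>) * (\<tau> * p) \<le> (\<Sum>x\<in>P. g x)"
  shows "\<delta> ^ 5 / 512 * \<tau> ^ 3 * (real p)\<^sup>2 \<le> triples g"
proof -
  define A where "A = {x\<in>P. \<delta> * \<tau> / 4 \<le> g x}"
  have A: "A \<subseteq> P" by (auto simp: A_def)
  have "(\<Sum>x\<in>P. g x) \<le> (\<Sum>x\<in>P. ind A x * (\<tau> * (1 + \<delta> / 4)) + \<delta> * \<tau> / 4)"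
  proof (rule sum_mono)
    fix x assume "x \<in> P"
    moreover have "0 < \<delta> * \<tau>" using \<delta> t by simp
    ultimately show "g x \<le> ind A x * (\<tau> * (1 + \<delta> / 4)) + \<delta> * \<tau> / 4"
      using g(3)[of x] by (auto simp: ind_def A_def)
  qed
  also have "\<dots> = card A * (\<tau> * (1 + \<delta> / 4)) + p * (\<delta> * \<tau> / 4)"
    using sum_ind[OF A, where 'a=real] by (simp add: sum.distrib flip: sum_distrib_right)
  finally have "\<tau> * ((1/3 + \<delta>) * p) \<le> \<tau> * (card A * (1 + \<delta> / 4) + p * (\<delta> / 4))"
    using dens by (simp add: algebra_simps)
  then have low: "(1/3 + \<delta>) * p \<le> card A * (1 + \<delta> / 4) + p * (\<delta> / 4)"
    using t by (simp only: mult_le_cancel_left)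
  \<comment> \<open>A smaller \<open>A\<close> would give
    \<open>3 * card A * (1 + \<delta> / 4)\<close> below \<open>p + (3/2) * p * \<delta>\<close>,
    using \<open>\<delta>^2 \<le> \<delta>\<close>, whereas \<open>low\<close> demands at least
    \<open>p + (9/4) * p * \<delta>\<close>.\<close>
  have big: "(1 + \<delta>) * p \<le> 3 * card A"
  proof (rule ccontr)
    assume "\<not> ?thesis"
    then have "3 * card A * (1 + \<delta> / 4) < (1 + \<delta>) * p * (1 + \<delta> / 4)"
      using \<delta> by (intro mult_strict_right_mono) auto
    also have "\<dots> = p * (1 + 5 * \<delta> / 4) + p * \<delta> * \<delta> / 4" by (simp add: algebra_simps)
    also have "\<dots> \<le> p * (1 + 5 * \<delta> / 4) + p * \<delta> * 1 / 4"
      using \<delta> by (intro add_left_mono divide_right_mono mult_left_mono) auto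
    finally have "3 * (card A * (1 + \<delta> / 4)) < p + 3 / 2 * (p * \<delta>)" by (simp add: algebra_simps)
    moreover have "p + 9 / 4 * (p * \<delta>) \<le> 3 * (card A * (1 + \<delta> / 4))"
      using low by (simp add: algebra_simps)
    moreover have "0 < p * \<delta>" using \<delta> p_pos by simp
    ultimately show False by linarith
  qed
  have lower: "\<delta> * \<tau> / 4 * ind A x \<le> g x" for x
  proof (cases "x mod int p \<in> A")
    case True
    then show ?thesis using periodic_cong[OF g(1), of "x mod int p" x] by (simp add: ind_def A_def)
  qed (simp add: ind_def g(2))
  have nn: "0 \<le> \<delta> * \<tau> / 4 * ind A x" for x using \<delta> t by (simp add: ind_def)
  have "(\<delta> * \<tau> / 4) ^ 3 * (\<delta>\<^sup>2 * (real p)\<^sup>2 / 8) \<le> (\<delta> * \<tau> / 4) ^ 3 * triples (ind A)"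
    using triples_ind_ge[OF A \<delta> big] \<delta> t by (intro mult_left_mono) auto
  also have "\<dots> = triples (\<lambda>x. \<delta> * \<tau> / 4 * ind A x)"
    unfolding triples_def by (simp add: sum_distrib_left power3_eq_cube mult_ac)
  also have "\<dots> \<le> triples g"
    unfolding triples_def
    by (intro sum_mono mult_mono lower nn mult_nonneg_nonneg g(2))
  also have "(\<delta> * \<tau> / 4) ^ 3 * (\<delta>\<^sup>2 * (real p)\<^sup>2 / 8) = \<delta> ^ 5 / 512 * \<tau> ^ 3 * (real p)\<^sup>2"
    by (simp add: power_mult_distrib power_divide numeral_eq_Suc)
  finally show ?thesis .
qed

text \<open>If \<open>S\<close> were too dense, its smoothing \<open>g\<close> would have
  \<open>triples g\<close> at least \<open>k * \<tau>^3 * p^2\<close>, while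
  \<open>triples (ind S) = 0\<close> and smoothing changes the count by at most half of that.
  \<open>large\<close> bounds the spectrum, \<open>M\<close> makes the kernel close to 1 on it, and
  \<open>cells\<close> makes \<open>Q\<close> large compared with
  \<open>sqrt p / (\<delta> * \<tau>)\<close>.\<close>

lemma sum_free_card_le:
  fixes \<delta> \<tau> k :: real and M :: nat
  assumes G: "\<Gamma> \<subseteq> P" "\<Gamma> \<noteq> {}" "0 \<notin> \<Gamma>"
    and closed: "\<And>g x. g \<in> \<Gamma> \<Longrightarrow> x \<in> \<Gamma> \<Longrightarrow> (g * x) mod int p \<in> \<Gamma>"
    and S: "S \<subseteq> \<Gamma>" and sf: "\<And>x y. x \<in> S \<Longrightarrow> y \<in> S \<Longrightarrow> (x + y) mod int p \<notin> S"
    and \<delta>: "0 < \<delta>" "\<delta> \<le> 1" "4 \<le> \<delta> * p"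
    and tau: "\<tau> = card \<Gamma> / p" and k: "k = \<delta> ^ 5 / 512"
    and large: "8 \<le> k\<^sup>2 * \<tau> ^ 3 * sqrt p"
    and M: "24 * pi \<le> k * \<tau> * M"
    and cells: "4 * real M ^ nat \<lfloor>8 / (k\<^sup>2 * \<tau>\<^sup>2)\<rfloor> \<le> \<delta> * \<tau> * sqrt p"
  shows "real (card S) \<le> (1/3 + \<delta>) * real (card \<Gamma>)"
proof (rule ccontr)
  assume dens: "\<not> ?thesis"
  define n where "n = real (card \<Gamma>)"
  define \<theta> where "\<theta> = k / 2 * \<tau> * n"
  define R where "R = {r\<in>P. \<theta> \<le> cmod (fourier (ind S) r)}"
  have SP: "S \<subseteq> P" using S G by auto
  have fin: "finite \<Gamma>" using G finite_subset[of \<Gamma> P] by auto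
  have n: "0 < n" using G fin by (auto simp: n_def card_gt_0_iff)
  have t: "0 < \<tau>" using n p_pos by (simp add: tau n_def)
  have np: "n = \<tau> * p" using p_pos by (simp add: tau n_def)
  have k0: "0 < k" using \<delta> by (simp add: k)
  have th: "0 < \<theta>" using k0 t n by (simp add: \<theta>_def)
  have Sn: "card S \<le> n" using S fin by (simp add: n_def card_mono)
  have "0 < k * \<tau> * M" using M pi_gt_zero by linarith
  then have M0: "0 < M" by (cases M) auto
  have "real (card R) \<le> 8 / (k\<^sup>2 * \<tau>\<^sup>2)"
    using card_large_spectrum_le[OF G closed S k0 tau large] by (simp add: R_def \<theta>_def n_def)
  then have cR: "card R \<le> nat \<lfloor>8 / (k\<^sup>2 * \<tau>\<^sup>2)\<rfloor>" by linarith
  have fR: "finite R" by (rule finite_subset[of R P]) (auto simp: R_def)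
  obtain Q where Q: "Q \<subseteq> P" "Q \<noteq> {}" and Qbig: "p \<le> card Q * M ^ card R"
    and close: "\<And>r x y. r \<in> R \<Longrightarrow> x \<in> Q \<Longrightarrow> y \<in> Q
      \<Longrightarrow> int M * \<bar>(r * x) mod int p - (r * y) mod int p\<bar> \<le> int p"
    using exists_cell[OF fR M0] by metis
  have m: "0 < card Q" using Q finite_subset[of Q P] by (auto simp: card_gt_0_iff)
  have small: "sqrt p / card Q \<le> \<delta> * \<tau> / 4"
  proof -
    have "4 * real M ^ card R \<le> 4 * real M ^ nat \<lfloor>8 / (k\<^sup>2 * \<tau>\<^sup>2)\<rfloor>"
      using M0 cR by (intro mult_left_mono power_increasing) auto
    then have "card Q * (4 * real M ^ card R) \<le> card Q * (\<delta> * \<tau> * sqrt p)"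
      using cells by (intro mult_left_mono) auto
    moreover have "real p \<le> card Q * real M ^ card R"
      using Qbig by (metis of_nat_le_iff of_nat_mult of_nat_power)
    moreover have "(4 * sqrt p) * sqrt p = 4 * real p" by simp
    ultimately have "(4 * sqrt p) * sqrt p \<le> (card Q * (\<delta> * \<tau>)) * sqrt p"
      by (simp only: mult_ac)
    then have "4 * sqrt p \<le> card Q * (\<delta> * \<tau>)"
      using p_pos by (simp only: mult_le_cancel_right) auto
    then show ?thesis using m by (simp add: field_simps)
  qed
  define g where "g = smooth Q (ind S)"
  \<comment> \<open>The pointwise bound goes through \<open>\<Gamma>\<close>, for which the
    nontrivial coefficients are known to be at most \<open>sqrt p\<close>.\<close>
  have "g x \<le> smooth Q (ind \<Gamma>) x" for x
    unfolding g_def smooth_def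
    by (intro divide_right_mono sum_mono) (use S in \<open>auto simp: ind_def\<close>)
  moreover have "smooth Q (ind \<Gamma>) x \<le> \<tau> + sqrt p / card Q" for x
  proof -
    have "smooth Q (ind \<Gamma>) x \<le> (\<Sum>x\<in>P. ind \<Gamma> x) / p + sqrt p / card Q"
    proof (rule smooth_le[OF periodic_ind Q])
      fix r assume "r \<in> P" "r \<noteq> 0"
      then show "cmod (fourier (ind \<Gamma>) r) \<le> sqrt p"
        by (intro norm_fourier_mult_closed_le[OF G closed]) auto
    qed (simp add: ind_def)
    then show ?thesis by (simp add: sum_ind[OF G(1)] tau)
  qed
  ultimately have "g x \<le> \<tau> + sqrt p / card Q" for x by (rule order_trans)
  moreover have "\<tau> + \<delta> * \<tau> / 4 = \<tau> * (1 + \<delta> / 4)" by (simp add: algebra_simps)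
  ultimately have gle: "g x \<le> \<tau> * (1 + \<delta> / 4)" for x
    using small by (metis add_left_mono order_trans)
  have gsum: "(1/3 + \<delta>) * (\<tau> * p) \<le> (\<Sum>x\<in>P. g x)"
    using dens sum_smooth[OF periodic_ind Q, of S] sum_ind[OF SP, where 'a=real] np
    by (simp add: g_def n_def)
  have per: "periodic g" by (simp add: g_def periodic_smooth periodic_ind)
  have g0: "0 \<le> g x" for x
    unfolding g_def smooth_def by (intro divide_nonneg_nonneg sum_nonneg) (simp_all add: ind_def)
  have "k * \<tau> ^ 3 * (real p)\<^sup>2 \<le> triples g"
    unfolding k by (rule triples_ge_of_bounded[OF per g0 gle \<delta> t gsum])
  moreover have "\<bar>triples (ind S) - triples g\<bar> \<le> \<theta> * card S"
    unfolding g_def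
  proof (rule triples_smooth_diff_le[OF SP Q(1)])
    fix r assume r: "r \<in> P"
    let ?x = "kernel Q r"
    have x: "0 \<le> ?x" "?x \<le> 1" by (simp_all add: kernel_nonneg kernel_le_1[OF Q(1)])
    show "cmod (fourier (ind S) r) * (1 - ?x ^ 3) \<le> \<theta>"
    proof (cases "r \<in> R")
      case True
      \<comment> \<open>This product equals \<open>3 * (1 - x) - (1 - x^3)\<close>.\<close>
      have "0 \<le> (1 - ?x)\<^sup>2 * (?x + 2)" using x by simp
      then have "1 - ?x ^ 3 \<le> 3 * (1 - ?x)"
        by (simp add: power2_eq_square power3_eq_cube algebra_simps)
      also have "\<dots> \<le> 3 * (4 * pi / M)"
        using kernel_cell_ge[OF Q M0 close[OF True]] by simp
      also have "\<dots> \<le> k * \<tau> / 2" using M M0 by (simp add: field_simps)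
      finally have "cmod (fourier (ind S) r) * (1 - ?x ^ 3) \<le> n * (k * \<tau> / 2)"
        using norm_fourier_ind_le[OF SP, of r] Sn n x
        by (intro mult_mono) (auto simp: power_le_one)
      then show ?thesis by (simp add: \<theta>_def mult_ac)
    next
      case False
      then have "cmod (fourier (ind S) r) \<le> \<theta>" using r by (simp add: R_def)
      then have "cmod (fourier (ind S) r) * (1 - ?x ^ 3) \<le> \<theta> * 1"
        using x th by (intro mult_mono) (auto simp: power_le_one)
      then show ?thesis by simp
    qed
  qed
  moreover have "\<theta> * card S \<le> \<theta> * n" using Sn th by (intro mult_left_mono) auto
  moreover have "\<theta> * n = k * \<tau> ^ 3 * (real p)\<^sup>2 / 2"
    by (simp add: \<theta>_def np power2_eq_square power3_eq_cube)
  moreover have "triples (ind S) = 0" by (rule triples_sum_free[OF SP sf])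
  moreover have "0 < k * \<tau> ^ 3 * (real p)\<^sup>2" using k0 t p_pos by simp
  ultimately show False by linarith
qed

end

subsection \<open>The asymptotic statement\<close>

text \<open>The threshold for \<open>p\<close> must be uniform in \<open>\<tau>\<close>. All
  conditions become easier as \<open>\<tau>\<close> grows, so they are checked at the least density
  \<open>T p\<close>, with \<open>M\<close> of order \<open>1 / \<tau>\<close>.\<close>

lemma density_conditions_eventually:
  fixes c \<delta> k :: real
  assumes c: "0 < c" and \<delta>: "0 < \<delta>" and k: "0 < k" "k \<le> 1"
  shows "\<forall>\<^sub>F p::nat in sequentially.
    \<forall>\<tau>. c * ((ln (ln (real p)))\<^sup>2 / sqrt (ln (real p))) \<le> \<tau> \<longrightarrow> \<tau> \<le> 1 \<longrightarrow>
      8 \<le> k\<^sup>2 * \<tau> ^ 3 * sqrt p \<and>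
      (\<exists>M::nat. 24 * pi \<le> k * \<tau> * M \<and>
        4 * real M ^ nat \<lfloor>8 / (k\<^sup>2 * \<tau>\<^sup>2)\<rfloor> \<le> \<delta> * \<tau> * sqrt p)"
proof -
  define T where "T x = c * ((ln (ln x))\<^sup>2 / sqrt (ln x))" for x
  \<comment> \<open>The extra 1 pays for rounding \<open>M\<close> up, since
    \<open>1 \<le> 1 / \<tau>\<close>.\<close>
  define C where "C = 24 * pi / k + 1"
  define B where "B = 8 / k\<^sup>2"
  have C: "1 < C" using k by (simp add: C_def)
  have B: "0 < B" using k by (simp add: B_def)
  have "\<forall>\<^sub>F x in at_top. 0 < T x"
    unfolding T_def using c by real_asymp
  moreover have "\<forall>\<^sub>F x in at_top. 8 \<le> k\<^sup>2 * T x ^ 3 * sqrt x"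
    unfolding T_def using c k(1) by real_asymp
  \<comment> \<open>The logarithm of the power is of order \<open>ln x / (ln (ln x))^3\<close>,
    hence \<open>o(ln x)\<close>, so the power grows more slowly than any positive power of
    \<open>x\<close>.\<close>
  moreover have "\<forall>\<^sub>F x in at_top. 4 * (C / T x) powr (B / (T x)\<^sup>2) \<le> \<delta> * T x * sqrt x"
    unfolding T_def using c \<delta> B order.strict_trans[OF zero_less_one C] by real_asymp
  ultimately have "\<forall>\<^sub>F x in at_top. 0 < T x \<and> 8 \<le> k\<^sup>2 * T x ^ 3 * sqrt x
      \<and> 4 * (C / T x) powr (B / (T x)\<^sup>2) \<le> \<delta> * T x * sqrt x"
    by eventually_elim simp
  then have "\<forall>\<^sub>F p::nat in sequentially. 0 < T p \<and> 8 \<le> k\<^sup>2 * T p ^ 3 * sqrt p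
      \<and> 4 * (C / T p) powr (B / (T p)\<^sup>2) \<le> \<delta> * T p * sqrt p"
    by (rule eventually_compose_filterlim[OF _ filterlim_real_sequentially])
  then show ?thesis
  proof (eventually_elim, intro allI impI conjI)
    fix p :: nat and \<tau> :: real
    assume a: "0 < T p \<and> 8 \<le> k\<^sup>2 * T p ^ 3 * sqrt p
      \<and> 4 * (C / T p) powr (B / (T p)\<^sup>2) \<le> \<delta> * T p * sqrt p"
      and "c * ((ln (ln (real p)))\<^sup>2 / sqrt (ln (real p))) \<le> \<tau>" and t1: "\<tau> \<le> 1"
    then have tT: "T p \<le> \<tau>" and T: "0 < T p" and t: "0 < \<tau>" by (auto simp: T_def)
    have "k\<^sup>2 * T p ^ 3 * sqrt p \<le> k\<^sup>2 * \<tau> ^ 3 * sqrt p"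
      using T tT by (intro mult_right_mono mult_left_mono power_mono) auto
    then show "8 \<le> k\<^sup>2 * \<tau> ^ 3 * sqrt p" using a by linarith
    define M where "M = nat \<lceil>24 * pi / (k * \<tau>)\<rceil>"
    define d where "d = nat \<lfloor>8 / (k\<^sup>2 * \<tau>\<^sup>2)\<rfloor>"
    have pos: "0 < 24 * pi / (k * \<tau>)" using k t by simp
    have M1: "24 * pi / (k * \<tau>) \<le> M" unfolding M_def by linarith
    have "real M \<le> 24 * pi / (k * \<tau>) + 1" unfolding M_def using pos by linarith
    also have "\<dots> \<le> 24 * pi / (k * \<tau>) + 1 / \<tau>" using t t1 by simp
    also have "\<dots> = C / \<tau>" using k t by (simp add: C_def field_simps)
    also have "\<dots> \<le> C / T p" using C T tT by (intro divide_left_mono) auto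
    finally have M2: "real M \<le> C / T p" .
    have CT: "1 \<le> C / T p" using C T tT t1 by simp
    have "real d \<le> 8 / (k\<^sup>2 * \<tau>\<^sup>2)" unfolding d_def using k t by simp
    also have "\<dots> = B / \<tau>\<^sup>2" by (simp add: B_def)
    also have "\<dots> \<le> B / (T p)\<^sup>2"
      using B T tT t by (intro divide_left_mono power_mono) auto
    finally have d: "real d \<le> B / (T p)\<^sup>2" .
    have "real M ^ d \<le> (C / T p) ^ d" using M2 by (intro power_mono) auto
    also have "\<dots> = (C / T p) powr real d" using CT by (simp add: powr_realpow)
    also have "\<dots> \<le> (C / T p) powr (B / (T p)\<^sup>2)" using d CT by (intro powr_mono) auto
    finally have "4 * real M ^ d \<le> \<delta> * T p * sqrt p" using a by linarith
    also have "\<dots> \<le> \<delta> * \<tau> * sqrt p"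
      using tT \<delta> by (intro mult_right_mono mult_left_mono) auto
    finally have "4 * real M ^ nat \<lfloor>8 / (k\<^sup>2 * \<tau>\<^sup>2)\<rfloor> \<le> \<delta> * \<tau> * sqrt p" by (simp add: d_def)
    moreover have "24 * pi \<le> k * \<tau> * M" using M1 k t by (simp add: pos_divide_le_eq mult_ac)
    ultimately show "\<exists>M::nat. 24 * pi \<le> k * \<tau> * M \<and>
        4 * real M ^ nat \<lfloor>8 / (k\<^sup>2 * \<tau>\<^sup>2)\<rfloor> \<le> \<delta> * \<tau> * sqrt p" by blast
  qed
qed

section \<open>Attainment of the maximum, and subgroups as sets of residues\<close>

lemma sf_obtain:
  assumes "finite \<Gamma>"
  obtains S where "S \<subseteq> \<Gamma>" "sum_free R S" "card S = sf R \<Gamma>"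
proof -
  let ?X = "{card S | S. S \<subseteq> \<Gamma> \<and> sum_free R S}"
  have "?X \<subseteq> card ` Pow \<Gamma>" by auto
  then have "finite ?X" using assms finite_subset by blast
  moreover have "card {} \<in> ?X" by (force simp: sum_free_def)
  ultimately have "Max ?X \<in> ?X" by (intro Max_in) auto
  then show ?thesis using that unfolding sf_def by auto
qed

lemma (in zmod) subgroup_units_residue_ring:
  assumes "subgroup \<Gamma> (units_of (residue_ring (int p)))"
  shows "\<Gamma> \<subseteq> P" "\<Gamma> \<noteq> {}" "0 \<notin> \<Gamma>"
    and "\<And>g x. g \<in> \<Gamma> \<Longrightarrow> x \<in> \<Gamma> \<Longrightarrow> (g * x) mod int p \<in> \<Gamma>"
proof -
  have p1: "1 < p" using prime_gt_1_nat[OF prime_p] .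
  have sub: "\<Gamma> \<subseteq> Units (residue_ring (int p))"
    using subgroup.subset[OF assms] by (simp add: units_of_def)
  then show "\<Gamma> \<subseteq> P" by (auto simp: Units_def residue_ring_def)
  show "\<Gamma> \<noteq> {}" using subgroup.one_closed[OF assms] by blast
  show "0 \<notin> \<Gamma>"
  proof
    assume "0 \<in> \<Gamma>"
    then have "0 \<in> Units (residue_ring (int p))" using sub by blast
    then show False using p1 by (auto simp: Units_def residue_ring_def)
  qed
  fix g x assume "g \<in> \<Gamma>" "x \<in> \<Gamma>"
  from subgroup.m_closed[OF assms this] show "(g * x) mod int p \<in> \<Gamma>"
    by (simp add: units_of_def residue_ring_def)
qed

theorem theorem10:
  fixes c :: real
  assumes "c > 0"
  shows "\<exists>\<epsilon> :: nat \<Rightarrow> real. \<epsilon> \<longlonglongrightarrow> 0 \<and>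
    (\<forall>(p::nat) (\<Gamma>::int set).
       prime p \<longrightarrow>
       subgroup \<Gamma> (units_of (residue_ring (int p))) \<longrightarrow>
       real (card \<Gamma>) \<ge> c * ((ln (ln (real p)))\<^sup>2 / sqrt (ln (real p))) * real p \<longrightarrow>
       real (sf (residue_ring (int p)) \<Gamma>) \<le> (1 / 3 + \<epsilon> p) * real (card \<Gamma>))"
proof -
  define X where "X p = {\<Gamma>. prime p \<and> subgroup \<Gamma> (units_of (residue_ring (int p))) \<and>
    c * ((ln (ln (real p)))\<^sup>2 / sqrt (ln (real p))) * real p \<le> real (card \<Gamma>)}" for p :: nat
  define f where "f p \<Gamma> = real (sf (residue_ring (int p)) \<Gamma>) / real (card \<Gamma>) - 1/3" for p :: nat and \<Gamma>
  \<comment> \<open>The worst excess over 1/3 among the finitely many admissible subgroups for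
    \<open>p\<close>. Inserting 0 makes the maximum defined when there are none, and keeps it
    nonnegative.\<close>
  define \<epsilon> where "\<epsilon> p = Max (insert 0 (f p ` X p))" for p
  have finX: "finite (X p)" for p
  proof (cases "prime p")
    case True
    then interpret zmod p by unfold_locales
    have "X p \<subseteq> Pow P" using subgroup_units_residue_ring(1) by (auto simp: X_def)
    then show ?thesis by (rule finite_subset) simp
  qed (simp add: X_def)
  have card_pos: "0 < card \<Gamma>" if "\<Gamma> \<in> X p" for p \<Gamma>
  proof -
    interpret zmod p using that by unfold_locales (simp add: X_def)
    have "subgroup \<Gamma> (units_of (residue_ring (int p)))" using that by (simp add: X_def)
    note G = subgroup_units_residue_ring[OF this]
    show ?thesis using G(2) finite_subset[OF G(1)] by (simp add: card_gt_0_iff)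
  qed
  have \<epsilon>0: "0 \<le> \<epsilon> p" for p unfolding \<epsilon>_def using finX[of p] by (intro Max_ge) auto
  have bound: "\<forall>\<^sub>F p in sequentially. \<epsilon> p \<le> \<delta>" if \<delta>: "0 < \<delta>" "\<delta> \<le> 1" for \<delta>
  proof -
    define k where "k = \<delta> ^ 5 / 512"
    have k: "0 < k" "k \<le> 1" using \<delta> power_le_one[of \<delta> 5] by (auto simp: k_def)
    have "\<forall>\<^sub>F p::nat in sequentially. 4 \<le> \<delta> * p" using \<delta> by real_asymp
    then show ?thesis using density_conditions_eventually[OF assms \<delta>(1) k]
    proof eventually_elim
      case (elim p)
      have "f p \<Gamma> \<le> \<delta>" if X: "\<Gamma> \<in> X p" for \<Gamma>
      proof -
        interpret zmod p using X by unfold_locales (simp add: X_def)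
        have "subgroup \<Gamma> (units_of (residue_ring (int p)))" using X by (simp add: X_def)
        note G = subgroup_units_residue_ring[OF this]
        define \<tau> where "\<tau> = card \<Gamma> / p"
        have "c * ((ln (ln (real p)))\<^sup>2 / sqrt (ln (real p))) \<le> \<tau>"
          using X p_pos by (simp add: X_def \<tau>_def pos_le_divide_eq)
        moreover have "\<tau> \<le> 1" using card_mono[OF _ G(1)] p_pos by (simp add: \<tau>_def)
        ultimately obtain M :: nat where M: "8 \<le> k\<^sup>2 * \<tau> ^ 3 * sqrt p" "24 * pi \<le> k * \<tau> * M"
          "4 * real M ^ nat \<lfloor>8 / (k\<^sup>2 * \<tau>\<^sup>2)\<rfloor> \<le> \<delta> * \<tau> * sqrt p"
          using elim(2) by blast
        obtain S where S: "S \<subseteq> \<Gamma>" "sum_free (residue_ring (int p)) S"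
          "card S = sf (residue_ring (int p)) \<Gamma>"
          using sf_obtain finite_subset[OF G(1)] by blast
        have "real (card S) \<le> (1/3 + \<delta>) * real (card \<Gamma>)"
        proof (rule sum_free_card_le[OF G S(1) _ \<delta> elim(1) \<tau>_def k_def M])
          fix x y assume "x \<in> S" "y \<in> S"
          then show "(x + y) mod int p \<notin> S"
            using S(2) by (fastforce simp: sum_free_def residue_ring_def)
        qed
        then show ?thesis using S(3) card_pos[OF X] by (simp add: f_def field_simps)
      qed
      then show ?case using finX[of p] \<delta> by (simp add: \<epsilon>_def)
    qed
  qed
  have "\<epsilon> \<longlonglongrightarrow> 0"
  proof (rule tendstoI)
    fix r :: real assume "0 < r"
    \<comment> \<open>\<open>bound\<close> requires \<open>\<delta> \<le> 1\<close>, hence the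
      minimum; halving \<open>r\<close> gives the strict inequality.\<close>
    then have "\<forall>\<^sub>F p in sequentially. \<epsilon> p \<le> min (r / 2) 1" by (intro bound) auto
    then show "\<forall>\<^sub>F p in sequentially. dist (\<epsilon> p) 0 < r"
      by eventually_elim (use \<epsilon>0 \<open>0 < r\<close> in \<open>auto simp: dist_real_def\<close>)
  qed
  moreover have "real (sf (residue_ring (int p)) \<Gamma>) \<le> (1 / 3 + \<epsilon> p) * real (card \<Gamma>)"
    if "prime p" "subgroup \<Gamma> (units_of (residue_ring (int p)))"
      "real (card \<Gamma>) \<ge> c * ((ln (ln (real p)))\<^sup>2 / sqrt (ln (real p))) * real p" for p \<Gamma>
  proof -
    have X: "\<Gamma> \<in> X p" using that by (simp add: X_def)
    then have "f p \<Gamma> \<le> \<epsilon> p" unfolding \<epsilon>_def using finX[of p] by (intro Max_ge) auto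
    then show ?thesis using card_pos[OF X] by (simp add: f_def field_simps)
  qed
  ultimately show ?thesis by blast
qed

end
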